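(* Let $\mathbb{F}$ be an algebraically closed field, let $\lambda_0\in\mathbb{F}$, let $G(\lambda)\in\mathbb{F}(\lambda)^{p\times m}$ and let $$P(\lambda)=\begin{bmatrix}A(\lambda)&B(\lambda)\\-C(\lambda)&D(\lambda)\end{bmatrix}\in\mathbb{F}[\lambda]^{(n+p)\times(n+m)}$$ be a polynomial system matrix, with state matrix $A(\lambda)\in\mathbb{F}[\lambda]^{n\times n}$, which is minimal at $\lambda_0$ and whose transfer function matrix is $G(\lambda)$. Then the elementary divisors of $A(\lambda)$ at $\lambda_0$ are the pole elementary divisors of $G(\lambda)$ at $\lambda_0$, and the elementary divisors of $P(\lambda)$ at $\lambda_0$ are the zero elementary divisors of $G(\lambda)$ at $\lambda_0$.
   Context: A square rational matrix is regular at $\lambda_0\in\mathbb{F}$ if none of its entries has a pole at $\lambda_0$ and its determinant is nonzero at $\lambda_0$. Every $G(\lambda)\in\mathbb{F}(\lambda)^{p\times m}$ of normal rank $r$ (rank over $\mathbb{F}(\lambda)$) can be written $G=R_1\,\mathrm{diag}\left((\lambda-\lambda_0)^{\nu_1},\ldots,(\lambda-\lambda_0)^{\nu_r},0_{(p-r)\times(m-r)}\right)R_2$ with $R_1,R_2$ rational and regular at $\lambda_0$, and with integers $\nu_1\le\cdots\le\nu_r$ uniquely determined by $G$ and $\lambda_0$, called the invariant orders of $G$ at $\lambda_0$. The pole elementary divisors of $G$ at $\lambda_0$ are the polynomials $(\lambda-\lambda_0)^{-\nu_i}$ for all $i$ with $\nu_i<0$, and the zero elementary divisors are $(\lambda-\lambda_0)^{\nu_i}$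 for all $i$ with $\nu_i>0$ (counted with repetition). For a polynomial matrix all $\nu_i\ge0$, and its elementary divisors at $\lambda_0$ are the $(\lambda-\lambda_0)^{\nu_i}$ with $\nu_i\neq0$. A polynomial system matrix is a polynomial matrix partitioned as $P(\lambda)=\begin{bmatrix}A&B\\-C&D\end{bmatrix}$ with $A(\lambda)$ an $n\times n$ polynomial matrix with $\det A(\lambda)\not\equiv0$ (if $n>0$); $A$ is its state matrix and $D+CA^{-1}B$ is its transfer function matrix. If $n=0$, the blocks $A,B,C$ are empty and $P=G=D$. For $n>0$, $P$ is minimal at $\lambda_0$ if $\operatorname{rank}\begin{bmatrix}A(\lambda_0)\\C(\lambda_0)\end{bmatrix}=\operatorname{rank}\begin{bmatrix}A(\lambda_0)&B(\lambda_0)\end{bmatrix}=n$; if $n=0$, $P$ is by convention minimal at every point of $\mathbb{F}$, and the empty matrix $A$ has no elementary divisors. *)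

theory Defs
  imports
    "HOL-Computational_Algebra.Polynomial_Factorial"
    "Jordan_Normal_Form.Gauss_Jordan_Elimination"
    "Jordan_Normal_Form.DL_Rank"
begin

text \<open>
  The field of rational functions is \<^typ>\<open>'a poly fract\<close>. Matrices are those of the
  Jordan_Normal_Form library, whose dimensions are natural numbers and may be zero.
\<close>

abbreviation to_rat_mat :: "'a :: field poly mat \<Rightarrow> 'a poly fract mat" where
  "to_rat_mat \<equiv> map_mat to_fract"

abbreviation eval_mat :: "'a :: field poly mat \<Rightarrow> 'a \<Rightarrow> 'a mat" where
  "eval_mat A x \<equiv> map_mat (\<lambda>q. poly q x) A"


text \<open>
  A rational function has a value at a point iff it has no pole there, that is, iff it can be
  written with a denominator that does not vanish at the point. The value does not depend on the
  representation.
\<close>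

definition has_value_at :: "'a :: field poly fract \<Rightarrow> 'a \<Rightarrow> 'a \<Rightarrow> bool" where
  "has_value_at f x v \<longleftrightarrow>
     (\<exists>a b. poly b x \<noteq> 0 \<and> f = Fract a b \<and> v = poly a x / poly b x)"

definition no_pole_at :: "'a :: field poly fract \<Rightarrow> 'a \<Rightarrow> bool" where
  "no_pole_at f x \<longleftrightarrow> (\<exists>v. has_value_at f x v)"

definition regular_at :: "'a :: field poly fract mat \<Rightarrow> 'a \<Rightarrow> bool" where
  "regular_at R x \<longleftrightarrow>
     square_mat R \<and>
     (\<forall>i < dim_row R. \<forall>j < dim_col R. no_pole_at (R $$ (i, j)) x) \<and>
     (\<exists>v. v \<noteq> 0 \<and> has_value_at (det R) x v)"


definition mat_rank :: "'a :: field mat \<Rightarrow> nat" where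
  "mat_rank A = vec_space.rank (dim_row A) A"

definition local_diag :: "nat \<Rightarrow> nat \<Rightarrow> 'a :: field \<Rightarrow> int list \<Rightarrow> 'a poly fract mat" where
  "local_diag p m x \<nu>s = mat p m (\<lambda>(i, j).
     if i = j \<and> i < length \<nu>s then to_fract [:-x, 1:] powi (\<nu>s ! i) else 0)"

definition is_invariant_orders :: "'a :: field poly fract mat \<Rightarrow> 'a \<Rightarrow> int list \<Rightarrow> bool" where
  "is_invariant_orders G x \<nu>s \<longleftrightarrow>
     sorted \<nu>s \<and> length \<nu>s = mat_rank G \<and>
     (\<exists>R\<^sub>1 \<in> carrier_mat (dim_row G) (dim_row G). \<exists>R\<^sub>2 \<in> carrier_mat (dim_col G) (dim_col G).
        regular_at R\<^sub>1 x \<and> regular_at R\<^sub>2 x \<and>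
        G = R\<^sub>1 * local_diag (dim_row G) (dim_col G) x \<nu>s * R\<^sub>2)"

definition invariant_orders :: "'a :: field poly fract mat \<Rightarrow> 'a \<Rightarrow> int list" where
  "invariant_orders G x = (THE \<nu>s. is_invariant_orders G x \<nu>s)"


definition pole_elementary_divisors :: "'a :: field poly fract mat \<Rightarrow> 'a \<Rightarrow> 'a poly multiset" where
  "pole_elementary_divisors G x =
     {# [:-x, 1:] ^ nat (- \<nu>). \<nu> \<in># filter_mset (\<lambda>\<nu>. \<nu> < 0) (mset (invariant_orders G x)) #}"

definition zero_elementary_divisors :: "'a :: field poly fract mat \<Rightarrow> 'a \<Rightarrow> 'a poly multiset" where
  "zero_elementary_divisors G x =
     {# [:-x, 1:] ^ nat \<nu>. \<nu> \<in># filter_mset (\<lambda>\<nu>. \<nu> > 0) (mset (invariant_orders G x)) #}"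

text \<open>
  For a polynomial matrix all invariant orders are nonnegative, so \<^const>\<open>nat\<close> loses nothing below.
\<close>

definition elementary_divisors :: "'a :: field poly mat \<Rightarrow> 'a \<Rightarrow> 'a poly multiset" where
  "elementary_divisors M x =
     {# [:-x, 1:] ^ nat \<nu>. \<nu> \<in># filter_mset (\<lambda>\<nu>. \<nu> \<noteq> 0)
          (mset (invariant_orders (to_rat_mat M) x)) #}"


definition system_matrix ::
  "'a :: field poly mat \<Rightarrow> 'a poly mat \<Rightarrow> 'a poly mat \<Rightarrow> 'a poly mat \<Rightarrow> 'a poly mat" where
  "system_matrix A B C D = four_block_mat A B (- C) D"

definition is_polynomial_system ::
  "nat \<Rightarrow> nat \<Rightarrow> nat \<Rightarrow>
   'a :: field poly mat \<Rightarrow> 'a poly mat \<Rightarrow> 'a poly mat \<Rightarrow> 'a poly mat \<Rightarrow> bool" where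
  "is_polynomial_system n p m A B C D \<longleftrightarrow>
     A \<in> carrier_mat n n \<and> B \<in> carrier_mat n m \<and> C \<in> carrier_mat p n \<and> D \<in> carrier_mat p m \<and>
     (n > 0 \<longrightarrow> det A \<noteq> 0)"

definition transfer_function ::
  "'a :: field poly mat \<Rightarrow> 'a poly mat \<Rightarrow> 'a poly mat \<Rightarrow> 'a poly mat \<Rightarrow> 'a poly fract mat" where
  "transfer_function A B C D =
     to_rat_mat D + to_rat_mat C * the (mat_inverse (to_rat_mat A)) * to_rat_mat B"

text \<open>
  For an empty state matrix the transfer function is \<open>D\<close> and the system matrix is \<open>D\<close>, so this
  case needs no separate clause in the definitions.
\<close>

lemma empty_state:
  assumes "is_polynomial_system 0 p m A B C D"
  shows "transfer_function A B C D = to_rat_mat D" "system_matrix A B C D = D"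
proof -
  from assms have c: "A \<in> carrier_mat 0 0" "B \<in> carrier_mat 0 m" "C \<in> carrier_mat p 0"
    "D \<in> carrier_mat p m"
    by (auto simp: is_polynomial_system_def)
  have A: "to_rat_mat A \<in> carrier_mat 0 0"
    using c by simp
  have "mat_inverse (to_rat_mat A) \<noteq> None"
  proof
    assume "mat_inverse (to_rat_mat A) = None"
    moreover have "to_rat_mat A * to_rat_mat A = 1\<^sub>m 0"
      using A by (intro eq_matI) auto
    ultimately show False
      using mat_inverse(1)[OF A, of undefined] A by (auto simp: Units_def ring_mat_def)
  qed
  then obtain X where X: "mat_inverse (to_rat_mat A) = Some X"
    by auto
  have "X \<in> carrier_mat 0 0"
    using mat_inverse(2)[OF A X] by auto
  then show "transfer_function A B C D = to_rat_mat D"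
    using c X by (intro eq_matI) (auto simp: transfer_function_def scalar_prod_def)
  show "system_matrix A B C D = D"
    using c by (intro eq_matI) (auto simp: system_matrix_def)
qed

definition append_cols :: "'a :: zero mat \<Rightarrow> 'a mat \<Rightarrow> 'a mat" where
  "append_cols A B = four_block_mat A B (0\<^sub>m 0 (dim_col A)) (0\<^sub>m 0 (dim_col B))"

definition minimal_at ::
  "'a :: field poly mat \<Rightarrow> 'a poly mat \<Rightarrow> 'a poly mat \<Rightarrow> 'a \<Rightarrow> bool" where
  "minimal_at A B C x \<longleftrightarrow>
     dim_row A = 0 \<or>
     mat_rank (eval_mat A x @\<^sub>r eval_mat C x) = dim_row A \<and>
     mat_rank (append_cols (eval_mat A x) (eval_mat B x)) = dim_row A"

end

theory Submission
  imports Defs "Jordan_Normal_Form.Column_Operations"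
begin

text \<open>
  The rational functions without a pole at a point form a valuation ring, and the matrices regular
  at the point are exactly the invertible matrices over it. Over any valuation ring pivoting on an
  entry that divides all others diagonalises a matrix up to such factors, and the diagonal is unique
  up to order and units.

  Let \<open>U G V = diag(g)\<close>, and write \<open>diag(g) = N E\<^sup>-\<^sup>1\<close> with coprime diagonal matrices \<open>N\<close> and \<open>E\<close>
  over the ring, so that \<open>E\<close> carries the poles and \<open>N\<close> the zeros. After replacing \<open>B, C, D\<close> by
  \<open>B V, U C, U D V\<close>, minimality yields local solutions of \<open>A X + B Y = I\<close> and \<open>Z A + W C = I\<close>.
  Put \<open>S = - A\<^sup>-\<^sup>1 B E\<close>. Then \<open>A S = - B E\<close> and \<open>- C S + D E = N\<close> are pole free, hence so is
  \<open>S = (Z A + W C) S\<close>, and multiplying \<open>[A, B; - C, D]\<close> and \<open>[A, B; 0, I]\<close> on the right by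
  \<open>[X, S; Y, E]\<close> gives \<open>[I, 0; *, N]\<close> and \<open>[I, 0; Y, E]\<close>. A Bezout identity between \<open>E\<close> and
  \<open>N\<close> shows that the multiplier is invertible over the ring. So \<open>P\<close> is equivalent to
  \<open>diag(I, N)\<close>, and \<open>diag(A, I)\<close> to \<open>diag(I, E)\<close>.
\<close>

section \<open>Rectangular diagonal matrices and rank\<close>

text \<open>\<open>f\<close> is total, but only its values below \<open>min p m\<close> are visible
  in the matrix.\<close>

definition rect_diag :: "nat \<Rightarrow> nat \<Rightarrow> (nat \<Rightarrow> 'a) \<Rightarrow> 'a :: zero mat" where
  "rect_diag p m f = mat p m (\<lambda>(i, j). if i = j then f i else 0)"

lemma rect_diag_carrier [simp]: "rect_diag p m f \<in> carrier_mat p m"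
  by (simp add: rect_diag_def)

lemma rect_diag_dim [simp]: "dim_row (rect_diag p m f) = p" "dim_col (rect_diag p m f) = m"
  by (simp_all add: rect_diag_def)

lemma rect_diag_index [simp]:
  "i < p \<Longrightarrow> j < m \<Longrightarrow> rect_diag p m f $$ (i, j) = (if i = j then f i else 0)"
  by (simp add: rect_diag_def)

lemma index_mult_mat_sum:
  assumes "M \<in> carrier_mat p q" "N \<in> carrier_mat q m" "i < p" "j < m"
  shows "(M * N) $$ (i, j) = (\<Sum>k < q. M $$ (i, k) * N $$ (k, j))"
  using assms by (auto simp: scalar_prod_def lessThan_atLeast0)

lemma index_rect_diag_mult:
  fixes M :: "'a :: comm_ring_1 mat"
  assumes "M \<in> carrier_mat m q" "i < p" "j < q"
  shows "(rect_diag p m f * M) $$ (i, j) = (if i < m then f i * M $$ (i, j) else 0)"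
proof -
  have "(rect_diag p m f * M) $$ (i, j) = (\<Sum>k < m. rect_diag p m f $$ (i, k) * M $$ (k, j))"
    using assms by (intro index_mult_mat_sum) auto
  also have "\<dots> = (\<Sum>k < m. if i = k then f i * M $$ (i, j) else 0)"
    using assms by (intro sum.cong) auto
  finally show ?thesis
    by simp
qed

lemma index_mult_rect_diag:
  fixes M :: "'a :: comm_ring_1 mat"
  assumes "M \<in> carrier_mat q p" "i < q" "j < m"
  shows "(M * rect_diag p m f) $$ (i, j) = (if j < p then M $$ (i, j) * f j else 0)"
proof -
  have "(M * rect_diag p m f) $$ (i, j) = (\<Sum>k < p. M $$ (i, k) * rect_diag p m f $$ (k, j))"
    using assms by (intro index_mult_mat_sum) auto
  also have "\<dots> = (\<Sum>k < p. if j = k then M $$ (i, j) * f j else 0)"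
    using assms by (intro sum.cong) auto
  finally show ?thesis
    by simp
qed

text \<open>The test \<open>i < m\<close> matters when the inner dimension is the smallest one: it
  then cuts the diagonal of the product short.\<close>

lemma rect_diag_mult:
  fixes f g :: "nat \<Rightarrow> 'a :: comm_ring_1"
  shows "rect_diag p m f * rect_diag m q g = rect_diag p q (\<lambda>i. if i < m then f i * g i else 0)"
proof (rule eq_matI)
  fix i j
  assume "i < dim_row (rect_diag p q (\<lambda>i. if i < m then f i * g i else 0))"
    and "j < dim_col (rect_diag p q (\<lambda>i. if i < m then f i * g i else 0))"
  then show "(rect_diag p m f * rect_diag m q g) $$ (i, j)
      = rect_diag p q (\<lambda>i. if i < m then f i * g i else 0) $$ (i, j)"
    by (subst index_rect_diag_mult[where q = q]) auto
qed auto

lemma rect_diag_cong: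
  "(\<And>i. i < p \<Longrightarrow> i < m \<Longrightarrow> f i = g i) \<Longrightarrow> rect_diag p m f = rect_diag p m g"
  by (intro eq_matI) auto

lemma one_mat_rect_diag: "1\<^sub>m n = rect_diag n n (\<lambda>_. 1)"
  by (intro eq_matI) auto

section \<open>Block-diagonal matrices\<close>

abbreviation block_diag :: "'a :: zero mat \<Rightarrow> 'a mat \<Rightarrow> 'a mat" where
  "block_diag M N \<equiv> four_block_mat M (0\<^sub>m (dim_row M) (dim_col N)) (0\<^sub>m (dim_row N) (dim_col M)) N"

lemma block_diag_mult:
  assumes "M \<in> carrier_mat a b" "M' \<in> carrier_mat b c" "N \<in> carrier_mat d e" "N' \<in> carrier_mat e f"
  shows "block_diag M N * block_diag M' N' = block_diag (M * M') (N * (N' :: 'a :: comm_ring_1 mat))"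
proof -
  have *: "M * M' \<in> carrier_mat a c" "N * N' \<in> carrier_mat d f"
    using assms by auto
  show ?thesis
    using assms * by (simp add: mult_four_block_mat[of _ a b _ e _ d _ _ c _ f])
qed

lemma block_diag_one_rect_diag:
  "block_diag (1\<^sub>m n) (rect_diag p m f) = rect_diag (n + p) (n + m) (\<lambda>i. if i < n then 1 else f (i - n))"
  by (intro eq_matI) auto

lemma block_diag_rect_diag_one:
  "block_diag (rect_diag n n f) (1\<^sub>m m) = rect_diag (n + m) (n + m) (\<lambda>i. if i < n then f i else 1)"
  by (intro eq_matI) auto

section \<open>Rank from left inverses and from factorizations\<close>

lemma rank_of_left_inverse:
  fixes M :: "'a :: field mat"
  assumes M: "M \<in> carrier_mat p r" and L: "L \<in> carrier_mat r p" "L * M = 1\<^sub>m r"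
  shows "vec_space.rank p M = r"
proof -
  interpret vec_space "TYPE('a)" p .
  \<comment> \<open>Independence of \<open>set (cols M)\<close> does not see repeated columns, so
    these are excluded separately: equal columns of \<open>M\<close> would give equal columns of the
    identity \<open>L * M\<close>.\<close>
  have "distinct (cols M)"
  proof (unfold distinct_conv_nth, intro allI impI notI)
    fix i j
    assume ij: "i < length (cols M)" "j < length (cols M)" "i \<noteq> j" "cols M ! i = cols M ! j"
    then have r: "i < r" "j < r" and "col M i = col M j"
      using M by simp_all
    then have "col (L * M) i = col (L * M) j"
      by (simp only: col_mult2[OF L(1) M])
    then have "unit_vec r i $ i = (unit_vec r j $ i :: 'a)"
      using r L(2) by simp
    with ij(3) r show False
      by simp
  qed
  moreover have "lin_indpt (set (cols M))"
  proof
    assume "lin_dep (set (cols M))"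
    from lin_depE[OF M this \<open>distinct (cols M)\<close>] obtain v where
      v: "v \<in> carrier_vec r" "v \<noteq> 0\<^sub>v r" "M *\<^sub>v v = 0\<^sub>v p" .
    \<comment> \<open>Applying \<open>L\<close> to the relation among the columns returns its
      coefficient vector, which is therefore zero.\<close>
    have "v = (L * M) *\<^sub>v v"
      using L v by simp
    also have "\<dots> = L *\<^sub>v (M *\<^sub>v v)"
      using L M v by (intro assoc_mult_mat_vec)
    also have "\<dots> = 0\<^sub>v r"
      unfolding v(3) using L by (intro eq_vecI) auto
    finally show False
      using v by simp
  qed
  ultimately show ?thesis
    by (intro lin_indpt_full_rank[OF M])
qed

text \<open>Each factorization puts one column space inside the other, and the rank is the dimension
  of the column space.\<close>

lemma rank_eq_of_factors:
  fixes M :: "'a :: field mat"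
  assumes M: "M \<in> carrier_mat p q" and N: "N \<in> carrier_mat p r"
    and X: "X \<in> carrier_mat r q" "M = N * X" and Y: "Y \<in> carrier_mat q r" "N = M * Y"
  shows "vec_space.rank p M = vec_space.rank p N"
proof -
  interpret vec_space "TYPE('a)" p .
  have sub: "col_space M' \<subseteq> col_space N'"
    if M': "M' \<in> carrier_mat p a" and N': "N' \<in> carrier_mat p b"
      and Z: "Z \<in> carrier_mat b a" "M' = N' * Z"
    for M' N' Z :: "'a mat" and a b
  proof
    fix y
    assume "y \<in> col_space M'"
    then obtain x where x: "x \<in> carrier_vec a" "y = M' *\<^sub>v x"
      using M' by (auto simp: col_space_eq[OF M'])
    then have "y = N' *\<^sub>v (Z *\<^sub>v x)" "Z *\<^sub>v x \<in> carrier_vec b"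
      using Z assoc_mult_mat_vec[OF N' Z(1) x(1)] by auto
    then show "y \<in> col_space N'"
      using N' by (auto simp: col_space_eq[OF N'])
  qed
  have "col_space M = col_space N"
    using sub[OF M N X] sub[OF N M Y] by blast
  then show ?thesis
    by (simp add: rank_def col_space_def)
qed

lemma mult_cancel_middle:
  fixes U :: "'a :: comm_ring_1 mat"
  assumes "U \<in> carrier_mat a b" "M \<in> carrier_mat b c" "V \<in> carrier_mat c d"
    and "V' \<in> carrier_mat d c" "N \<in> carrier_mat c e" "W \<in> carrier_mat e f" "V * V' = 1\<^sub>m c"
  shows "(U * M * V) * (V' * N * W) = U * (M * N) * W"
proof -
  note UM = mult_carrier_mat[OF assms(1,2)]
  note V'N = mult_carrier_mat[OF assms(4,5)]
  have "V * (V' * N * W) = V * (V' * N) * W"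
    by (rule assoc_mult_mat[OF assms(3) V'N assms(6), symmetric])
  also have "V * (V' * N) = V * V' * N"
    by (rule assoc_mult_mat[OF assms(3,4,5), symmetric])
  also have "\<dots> = N"
    using assms by simp
  finally have *: "V * (V' * N * W) = N * W" .
  have "(U * M * V) * (V' * N * W) = U * M * (V * (V' * N * W))"
    by (rule assoc_mult_mat[OF UM assms(3) mult_carrier_mat[OF V'N assms(6)]])
  also have "\<dots> = U * M * N * W"
    unfolding * by (rule assoc_mult_mat[OF UM assms(5,6), symmetric])
  also have "U * M * N = U * (M * N)"
    by (rule assoc_mult_mat[OF assms(1,2,5)])
  finally show ?thesis .
qed

section \<open>Matrices over a valuation ring\<close>

text \<open>Since \<open>inverse 0 = 0\<close>, the last axiom taken at 0 gives
  \<open>0 \<in> \<O>\<close>. The whole field is an instance, so the matrix theory below also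
  covers linear algebra over a field.\<close>

locale valuation_ring =
  fixes \<O> :: "'a :: field set"
  assumes one_mem: "1 \<in> \<O>"
    and minus_mem: "a \<in> \<O> \<Longrightarrow> - a \<in> \<O>"
    and add_mem: "a \<in> \<O> \<Longrightarrow> b \<in> \<O> \<Longrightarrow> a + b \<in> \<O>"
    and mult_mem: "a \<in> \<O> \<Longrightarrow> b \<in> \<O> \<Longrightarrow> a * b \<in> \<O>"
    and mem_or_inverse_mem: "a \<in> \<O> \<or> inverse a \<in> \<O>"
begin

lemma zero_mem: "0 \<in> \<O>"
  using mem_or_inverse_mem[of 0] by simp

lemma sum_mem: "(\<And>i. i \<in> I \<Longrightarrow> f i \<in> \<O>) \<Longrightarrow> sum f I \<in> \<O>"
  by (induction I rule: infinite_finite_induct) (auto intro: zero_mem add_mem)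

lemma prod_mem: "(\<And>i. i \<in> I \<Longrightarrow> f i \<in> \<O>) \<Longrightarrow> prod f I \<in> \<O>"
  by (induction I rule: infinite_finite_induct) (auto intro: one_mem mult_mem)

lemma signof_mem: "signof \<pi> \<in> \<O>"
  by (auto simp: sign_def intro: one_mem minus_mem)

lemma quotient_mem_or: "a / b \<in> \<O> \<or> b / a \<in> \<O>"
  using mem_or_inverse_mem[of "a / b"] by simp

text \<open>The maximal ideal. The case \<open>a = 0\<close> is listed because
  \<open>inverse 0 = 0\<close> does lie in \<open>\<O>\<close>.\<close>

definition nonunits :: "'a set" where
  "nonunits = {a \<in> \<O>. a = 0 \<or> inverse a \<notin> \<O>}"

lemma nonunits_mult:
  assumes a: "a \<in> \<O>" and b: "b \<in> nonunits"
  shows "a * b \<in> nonunits"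
proof -
  have "inverse b \<in> \<O>" if "a * b \<noteq> 0" "inverse (a * b) \<in> \<O>"
  proof -
    have "a * inverse (a * b) \<in> \<O>"
      using a that(2) by (rule mult_mem)
    moreover have "a * inverse (a * b) = inverse b"
      using that(1) by (simp add: field_simps)
    ultimately show ?thesis
      by (simp only:)
  qed
  then show ?thesis
    using assms by (auto simp: nonunits_def mult_mem simp del: inverse_mult_distrib)
qed

text \<open>Of two nonzero elements one divides the other; if \<open>b\<close> divides
  \<open>a\<close>, then \<open>a + b = (a / b + 1) * b\<close> is a multiple of the nonunit
  \<open>b\<close>.\<close>

lemma nonunits_add:
  assumes "a \<in> nonunits" "b \<in> nonunits"
  shows "a + b \<in> nonunits"
proof -
  have main: "a + b \<in> nonunits" if "a / b \<in> \<O>" "b \<in> nonunits" "b \<noteq> 0" for a b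
  proof -
    have "(a / b + 1) * b \<in> nonunits"
      using that by (intro nonunits_mult add_mem one_mem)
    with that show ?thesis
      by (simp add: distrib_right)
  qed
  consider "a = 0" | "b = 0" | "a / b \<in> \<O>" "b \<noteq> 0" | "b / a \<in> \<O>" "a \<noteq> 0"
    using quotient_mem_or by blast
  then show ?thesis
    using assms main[of a b] main[of b a] by cases (auto simp: add.commute)
qed

lemma nonunits_sum: "(\<And>i. i \<in> I \<Longrightarrow> f i \<in> nonunits) \<Longrightarrow> sum f I \<in> nonunits"
proof (induction I rule: infinite_finite_induct)
  case (insert i I)
  then show ?case
    by (simp add: nonunits_add)
qed (simp_all add: nonunits_def zero_mem)

section \<open>Matrices over the ring and their invertible elements\<close>

definition mats :: "nat \<Rightarrow> nat \<Rightarrow> 'a mat set" where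
  "mats p m = {M \<in> carrier_mat p m. \<forall>i < p. \<forall>j < m. M $$ (i, j) \<in> \<O>}"

definition GL :: "nat \<Rightarrow> 'a mat set" where
  "GL n = {U \<in> mats n n. \<exists>V \<in> mats n n. U * V = 1\<^sub>m n \<and> V * U = 1\<^sub>m n}"

lemma matsD: "M \<in> mats p m \<Longrightarrow> M \<in> carrier_mat p m"
  by (simp add: mats_def)

lemma GLD: "U \<in> GL n \<Longrightarrow> U \<in> mats n n" "U \<in> GL n \<Longrightarrow> U \<in> carrier_mat n n"
  by (simp_all add: GL_def mats_def)

lemma mats_mult: "M \<in> mats p q \<Longrightarrow> N \<in> mats q m \<Longrightarrow> M * N \<in> mats p m"
  by (auto simp: mats_def scalar_prod_def intro!: sum_mem mult_mem)

lemma mats_add: "M \<in> mats p m \<Longrightarrow> N \<in> mats p m \<Longrightarrow> M + N \<in> mats p m"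
  by (auto simp: mats_def intro!: add_mem)

lemma mats_uminus: "M \<in> mats p m \<Longrightarrow> - M \<in> mats p m"
  by (auto simp: mats_def intro!: minus_mem)

lemma mats_zero: "0\<^sub>m p m \<in> mats p m"
  by (auto simp: mats_def zero_mem)

lemma mats_one: "1\<^sub>m n \<in> mats n n"
  by (auto simp: mats_def zero_mem one_mem)

lemma mats_four_block:
  "M \<in> mats p m \<Longrightarrow> N \<in> mats p m' \<Longrightarrow> R \<in> mats p' m \<Longrightarrow> S \<in> mats p' m' \<Longrightarrow>
    four_block_mat M N R S \<in> mats (p + p') (m + m')"
  by (auto simp: mats_def)

lemma mats_rect_diag: "(\<And>i. i < p \<Longrightarrow> i < m \<Longrightarrow> f i \<in> \<O>) \<Longrightarrow> rect_diag p m f \<in> mats p m"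
  by (auto simp: mats_def zero_mem)

lemmas mats_intros = mats_mult mats_add mats_uminus mats_zero mats_one mats_four_block

lemma det_mem:
  assumes "M \<in> mats n n"
  shows "det M \<in> \<O>"
proof -
  have "M $$ (i, \<pi> i) \<in> \<O>" if "\<pi> permutes {0..<n}" "i < n" for \<pi> i
    using assms that permutes_in_image[OF that(1), of i] by (auto simp: mats_def)
  then show ?thesis
    using assms unfolding det_def'[OF matsD[OF assms]]
    by (auto intro!: sum_mem mult_mem prod_mem signof_mem)
qed

lemma GL_I:
  assumes "U \<in> mats n n" "V \<in> mats n n" "U * V = 1\<^sub>m n"
  shows "U \<in> GL n" "V \<in> GL n"
  using assms mat_mult_left_right_inverse[of U n V] by (auto simp: GL_def dest: matsD)

lemma GL_inverse:
  assumes "U \<in> GL n"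
  obtains V where "V \<in> GL n" "U * V = 1\<^sub>m n" "V * U = 1\<^sub>m n"
  using assms by (auto simp: GL_def)

lemma GL_one: "1\<^sub>m n \<in> GL n"
  unfolding GL_def using mats_one[of n] by force

lemma GL_mult:
  assumes U: "U \<in> GL n" and V: "V \<in> GL n"
  shows "U * V \<in> GL n"
proof -
  obtain U' where U': "U' \<in> GL n" "U * U' = 1\<^sub>m n"
    using U by (rule GL_inverse)
  obtain V' where V': "V' \<in> GL n" "V * V' = 1\<^sub>m n"
    using V by (rule GL_inverse)
  note c = GLD(2)[OF U] GLD(2)[OF V] GLD(2)[OF U'(1)] GLD(2)[OF V'(1)]
  have "(U * V) * (V' * U') = U * (V * (V' * U'))"
    using c by (intro assoc_mult_mat[of _ n n _ n _ n]) auto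
  also have "V * (V' * U') = V * V' * U'"
    using c by (intro assoc_mult_mat[of _ n n _ n _ n, symmetric]) auto
  finally have "(U * V) * (V' * U') = 1\<^sub>m n"
    using c U' V' by simp
  then show ?thesis
    using mats_mult[OF GLD(1)[OF U] GLD(1)[OF V]] mats_mult[OF GLD(1)[OF V'(1)] GLD(1)[OF U'(1)]]
    by (intro GL_I(1))
qed

lemma GL_block_diag:
  assumes "U \<in> GL n" "V \<in> GL m"
  shows "block_diag U V \<in> GL (n + m)"
proof -
  obtain U' where U': "U' \<in> GL n" "U * U' = 1\<^sub>m n"
    using assms(1) by (rule GL_inverse)
  obtain V' where V': "V' \<in> GL m" "V * V' = 1\<^sub>m m"
    using assms(2) by (rule GL_inverse)
  note d = assms[THEN GLD(1)] U'(1)[THEN GLD(1)] V'(1)[THEN GLD(1)]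
  note c = d[THEN matsD]
  have "block_diag U V * block_diag U' V' = 1\<^sub>m (n + m)"
    using c U' V' by (subst block_diag_mult[of U n n U' n V m m V' m]) simp_all
  moreover have "block_diag U V \<in> mats (n + m) (n + m)" "block_diag U' V' \<in> mats (n + m) (n + m)"
    using c d by (auto intro!: mats_intros)
  ultimately show ?thesis
    by (intro GL_I(1))
qed

lemma GL_lower_unitriangular:
  assumes "M \<in> mats m n"
  shows "four_block_mat (1\<^sub>m n) (0\<^sub>m n m) M (1\<^sub>m m) \<in> GL (n + m)"
proof -
  note c = matsD[OF assms]
  have "four_block_mat (1\<^sub>m n) (0\<^sub>m n m) M (1\<^sub>m m) * four_block_mat (1\<^sub>m n) (0\<^sub>m n m) (- M) (1\<^sub>m m)
      = 1\<^sub>m (n + m)"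
    using c by (simp add: mult_four_block_mat[of _ n n _ m _ m _ _ n _ m])
      (intro eq_matI, auto)
  then show ?thesis
    using assms by (intro GL_I(1)) (auto intro!: mats_intros)
qed

lemma GL_upper_unitriangular:
  assumes "M \<in> mats n m"
  shows "four_block_mat (1\<^sub>m n) M (0\<^sub>m m n) (1\<^sub>m m) \<in> GL (n + m)"
proof -
  note c = matsD[OF assms]
  have "four_block_mat (1\<^sub>m n) M (0\<^sub>m m n) (1\<^sub>m m) * four_block_mat (1\<^sub>m n) (- M) (0\<^sub>m m n) (1\<^sub>m m)
      = 1\<^sub>m (n + m)"
    using c by (simp add: mult_four_block_mat[of _ n n _ m _ m _ _ n _ m])
      (intro eq_matI, auto)
  then show ?thesis
    using assms by (intro GL_I(1)) (auto intro!: mats_intros)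
qed

lemma GL_swaprows_mat:
  assumes "k < n" "l < n"
  shows "swaprows_mat n k l \<in> GL n"
  using assms swaprows_mat_inv[OF assms]
  by (intro GL_I(1)[of _ _ "swaprows_mat n k l"]) (auto simp: mats_def one_mem zero_mem)

text \<open>The inverse is the adjugate divided by the determinant. Cofactors are signed
  determinants of submatrices over the ring, so only the division by \<open>det U\<close> could
  leave the ring.\<close>

lemma GL_of_unit_det:
  assumes U: "U \<in> mats n n" and det: "det U \<noteq> 0" "inverse (det U) \<in> \<O>"
  shows "U \<in> GL n"
proof -
  define V where "V = inverse (det U) \<cdot>\<^sub>m adj_mat U"
  note adj = adj_mat[OF matsD[OF U]]
  have "cofactor U j i \<in> \<O>" if "i < n" "j < n" for i j
  proof -
    have "mat_delete U j i \<in> mats (n - 1) (n - 1)"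
      using U that by (auto simp: mats_def mat_delete_def)
    moreover have "(- 1) ^ k \<in> \<O>" for k :: nat
      by (induction k) (auto intro: one_mem minus_mem)
    ultimately show ?thesis
      unfolding cofactor_def by (intro mult_mem det_mem)
  qed
  then have "V \<in> mats n n"
    using U det adj(1) by (auto simp: V_def mats_def adj_mat_def intro!: mult_mem)
  moreover have "U * V = 1\<^sub>m n"
    using det adj matsD[OF U] unfolding V_def
    by (subst mult_smult_distrib[of _ n n _ n]) (auto intro!: eq_matI)
  ultimately show ?thesis
    using U by (intro GL_I(1))
qed

lemma GL_det:
  assumes "U \<in> GL n"
  shows "det U \<noteq> 0" "inverse (det U) \<in> \<O>"
proof -
  obtain V where V: "V \<in> GL n" "U * V = 1\<^sub>m n"
    using assms by (rule GL_inverse)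
  then have "det U * det V = 1"
    using det_mult[of U n V] assms by (simp add: GLD)
  then show "det U \<noteq> 0" "inverse (det U) \<in> \<O>"
    using det_mem[OF GLD(1)[OF V(1)]] inverse_unique[of "det U" "det V"] by auto
qed

lemma mat_rank_of_rect_diag:
  assumes U: "U \<in> GL p" and V: "V \<in> GL m" and G: "G = U * rect_diag p m f * V"
    and r: "r \<le> p" "r \<le> m" and f: "\<And>i. i < r \<Longrightarrow> f i \<noteq> 0" "\<And>i. i \<ge> r \<Longrightarrow> f i = 0"
  shows "mat_rank G = r"
proof -
  obtain U' where U': "U' \<in> GL p" "U' * U = 1\<^sub>m p"
    using U by (rule GL_inverse)
  obtain V' where V': "V' \<in> GL m" "V * V' = 1\<^sub>m m"
    using V by (rule GL_inverse)
  note c [simp] = GLD(2)[OF U] GLD(2)[OF V] GLD(2)[OF U'(1)] GLD(2)[OF V'(1)]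
  \<comment> \<open>The first \<open>r\<close> columns of \<open>U\<close>. \<open>N\<close> and
    \<open>G\<close> factor through each other, the way from \<open>G\<close> to \<open>N\<close>
    dividing by the nonzero \<open>f i\<close>, so their ranks agree; the first \<open>r\<close>
    rows of \<open>U'\<close> form a left inverse of \<open>N\<close>.\<close>
  define N where "N = U * rect_diag p r (\<lambda>_. 1)"
  have N: "N \<in> carrier_mat p r"
    by (simp add: N_def mult_carrier_mat[OF c(1)])
  have Gc: "G \<in> carrier_mat p m"
    unfolding G by (rule mult_carrier_mat[OF mult_carrier_mat[OF c(1) rect_diag_carrier] c(2)])
  have "rect_diag p r (\<lambda>_. 1) * rect_diag r m f = rect_diag p m f"
    unfolding rect_diag_mult by (rule rect_diag_cong) (auto simp: f)
  then have "N * rect_diag r m f = U * rect_diag p m f"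
    unfolding N_def by (subst assoc_mult_mat[of _ p p _ r _ m]) simp_all
  then have "G = N * (rect_diag r m f * V)"
    unfolding G by (subst assoc_mult_mat[OF N _ c(2), symmetric]) simp_all
  moreover have "N = G * (V' * rect_diag m r (\<lambda>i. inverse (f i)))"
  proof -
    have "G * V' = U * rect_diag p m f * (V * V')"
      unfolding G by (rule assoc_mult_mat[of _ p m _ m _ m]) (auto intro: mult_carrier_mat[OF c(1)])
    then have "G * V' = U * rect_diag p m f"
      using V' by (simp add: mult_carrier_mat[OF c(1)])
    then have "G * (V' * rect_diag m r (\<lambda>i. inverse (f i)))
        = U * rect_diag p m f * rect_diag m r (\<lambda>i. inverse (f i))"
      by (subst assoc_mult_mat[OF Gc c(4) rect_diag_carrier, symmetric]) simp
    also have "\<dots> = U * (rect_diag p m f * rect_diag m r (\<lambda>i. inverse (f i)))"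
      by (rule assoc_mult_mat[of _ p p _ m _ r]) simp_all
    also have "rect_diag p m f * rect_diag m r (\<lambda>i. inverse (f i)) = rect_diag p r (\<lambda>_. 1)"
      unfolding rect_diag_mult using r by (intro rect_diag_cong) (auto simp: f)
    finally show ?thesis
      by (simp add: N_def)
  qed
  ultimately have "vec_space.rank p G = vec_space.rank p N"
    using mult_carrier_mat[OF rect_diag_carrier c(2)] mult_carrier_mat[OF c(4) rect_diag_carrier]
    by (intro rank_eq_of_factors[OF Gc N])
  moreover have "vec_space.rank p N = r"
  proof (rule rank_of_left_inverse[OF N])
    show "rect_diag r p (\<lambda>_. 1) * U' \<in> carrier_mat r p"
      by (rule mult_carrier_mat[OF rect_diag_carrier c(3)])
    have "rect_diag r p (\<lambda>_. 1) * U' * N = rect_diag r p (\<lambda>_. 1) * (U' * N)"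
      using N by (intro assoc_mult_mat[of _ r p _ p _ r]) simp_all
    also have "U' * N = U' * U * rect_diag p r (\<lambda>_. 1)"
      unfolding N_def by (rule assoc_mult_mat[of _ p p _ p _ r, symmetric]) simp_all
    also have "\<dots> = rect_diag p r (\<lambda>_. 1)"
      using U' by simp
    also have "rect_diag r p (\<lambda>_. 1 :: 'a) * rect_diag p r (\<lambda>_. 1) = 1\<^sub>m r"
      unfolding rect_diag_mult one_mat_rect_diag using r by (intro rect_diag_cong) auto
    finally show "rect_diag r p (\<lambda>_. 1) * U' * N = 1\<^sub>m r" .
  qed
  ultimately show ?thesis
    using Gc by (simp add: mat_rank_def)
qed

section \<open>Equivalence over the ring\<close>

text \<open>Requiring the dimensions of \<open>H\<close> suffices, since those of \<open>G\<close>
  follow from the factorization.\<close>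

definition equivalent :: "nat \<Rightarrow> nat \<Rightarrow> 'a mat \<Rightarrow> 'a mat \<Rightarrow> bool" where
  "equivalent p m G H \<longleftrightarrow> H \<in> carrier_mat p m \<and> (\<exists>U \<in> GL p. \<exists>V \<in> GL m. G = U * H * V)"

lemma equivalentI:
  "U \<in> GL p \<Longrightarrow> V \<in> GL m \<Longrightarrow> H \<in> carrier_mat p m \<Longrightarrow> G = U * H * V \<Longrightarrow> equivalent p m G H"
  by (auto simp: equivalent_def)

lemma equivalent_carrier:
  assumes "equivalent p m G H"
  shows "G \<in> carrier_mat p m" "H \<in> carrier_mat p m"
proof -
  show H: "H \<in> carrier_mat p m"
    using assms by (simp add: equivalent_def)
  show "G \<in> carrier_mat p m"
    using assms mult_carrier_mat[OF mult_carrier_mat[OF GLD(2) H] GLD(2)] by (auto simp: equivalent_def)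
qed

lemma equivalent_refl: "G \<in> carrier_mat p m \<Longrightarrow> equivalent p m G G"
  by (rule equivalentI[OF GL_one GL_one]) auto

lemma equivalent_sym:
  assumes "equivalent p m G H"
  shows "equivalent p m H G"
proof -
  obtain U V where UV: "U \<in> GL p" "V \<in> GL m" "G = U * H * V" and H: "H \<in> carrier_mat p m"
    using assms by (auto simp: equivalent_def)
  obtain U' where U': "U' \<in> GL p" "U' * U = 1\<^sub>m p"
    using UV(1) by (rule GL_inverse)
  obtain V' where V': "V' \<in> GL m" "V * V' = 1\<^sub>m m"
    using UV(2) by (rule GL_inverse)
  note c = GLD(2)[OF UV(1)] GLD(2)[OF UV(2)] GLD(2)[OF U'(1)] GLD(2)[OF V'(1)]
  note UH = mult_carrier_mat[OF c(1) H]
  have "U' * G * V' = U' * (G * V')"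
    using equivalent_carrier(1)[OF assms] c by (intro assoc_mult_mat)
  also have "G * V' = U * H * (V * V')"
    unfolding UV(3) using c UH by (intro assoc_mult_mat)
  also have "\<dots> = U * H"
    by (simp add: V' right_mult_one_mat[OF UH])
  also have "U' * (U * H) = U' * U * H"
    using c H by (intro assoc_mult_mat[symmetric])
  also have "\<dots> = H"
    using H U' by simp
  finally show ?thesis
    by (intro equivalentI[OF U'(1) V'(1) equivalent_carrier(1)[OF assms]]) simp
qed

lemma equivalent_trans:
  assumes "equivalent p m G H" "equivalent p m H K"
  shows "equivalent p m G K"
proof -
  obtain U V where UV: "U \<in> GL p" "V \<in> GL m" "G = U * H * V"
    using assms(1) by (auto simp: equivalent_def)
  obtain U' V' where UV': "U' \<in> GL p" "V' \<in> GL m" "H = U' * K * V'" and K: "K \<in> carrier_mat p m"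
    using assms(2) by (auto simp: equivalent_def)
  note c = GLD(2)[OF UV(1)] GLD(2)[OF UV(2)] GLD(2)[OF UV'(1)] GLD(2)[OF UV'(2)]
  note d = mult_carrier_mat[OF c(3) K]
  have "G = U * (U' * K) * V' * V"
    unfolding UV(3) UV'(3) by (simp only: assoc_mult_mat[OF c(1) d c(4)])
  also have "\<dots> = U * (U' * K) * (V' * V)"
    by (rule assoc_mult_mat[OF mult_carrier_mat[OF c(1) d] c(4) c(2)])
  also have "U * (U' * K) = U * U' * K"
    using c K by (intro assoc_mult_mat[symmetric])
  finally show ?thesis
    by (intro equivalentI[OF GL_mult[OF UV(1) UV'(1)] GL_mult[OF UV'(2) UV(2)] K])
qed

lemma equivalent_block_diag:
  assumes G: "equivalent p m G H" and G': "equivalent p' m' G' H'"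
  shows "equivalent (p + p') (m + m') (block_diag G G') (block_diag H H')"
proof -
  obtain U V where UV: "U \<in> GL p" "V \<in> GL m" "G = U * H * V" and H: "H \<in> carrier_mat p m"
    using G by (auto simp: equivalent_def)
  obtain U' V' where UV': "U' \<in> GL p'" "V' \<in> GL m'" "G' = U' * H' * V'" and H': "H' \<in> carrier_mat p' m'"
    using G' by (auto simp: equivalent_def)
  note c = GLD(2)[OF UV(1)] GLD(2)[OF UV(2)] GLD(2)[OF UV'(1)] GLD(2)[OF UV'(2)]
  have "block_diag U U' * block_diag H H' * block_diag V V' = block_diag G G'"
    unfolding UV(3) UV'(3)
    by (subst block_diag_mult[OF c(1) H c(3) H'],
        subst block_diag_mult[OF mult_carrier_mat[OF c(1) H] c(2) mult_carrier_mat[OF c(3) H'] c(4)]) simp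
  then show ?thesis
    by (intro equivalentI[OF GL_block_diag[OF UV(1) UV'(1)] GL_block_diag[OF UV(2) UV'(2)]])
       (use H H' in auto)
qed

section \<open>Uniqueness of the diagonal\<close>

text \<open>
  With \<open>W = V\<^sup>-\<^sup>1\<close>, the block of \<open>W\<close> with rows in the left index set and columns outside the right
  one consists of nonunits; if the left set were larger, every Leibniz term of \<open>det W\<close> would meet
  that block.
\<close>

lemma card_dividing_diag_le:
  assumes eq: "equivalent p m (rect_diag p m d) (rect_diag p m e)" and c: "c \<noteq> 0"
  shows "card {i. i < min p m \<and> d i \<noteq> 0 \<and> c / d i \<in> \<O>}
    \<le> card {i. i < min p m \<and> e i \<noteq> 0 \<and> c / e i \<in> \<O>}" (is "card ?I \<le> card ?J")
proof (rule ccontr)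
  assume less: "\<not> card ?I \<le> card ?J"
  obtain U V where UV: "U \<in> GL p" "V \<in> GL m" "rect_diag p m d = U * rect_diag p m e * V"
    using eq by (auto simp: equivalent_def)
  obtain W where W: "W \<in> GL m" "V * W = 1\<^sub>m m"
    using UV(2) by (rule GL_inverse)
  note carr = GLD(2)[OF UV(1)] GLD(2)[OF UV(2)] GLD(2)[OF W(1)]
  note Ue = mult_carrier_mat[OF carr(1) rect_diag_carrier[of p m e]]
  have "rect_diag p m d * W = U * rect_diag p m e * (V * W)"
    unfolding UV(3) using carr Ue by (intro assoc_mult_mat)
  then have dW: "rect_diag p m d * W = U * rect_diag p m e"
    using Ue W by simp
  have UO: "U $$ (i, j) \<in> \<O>" if "i < p" "j < p" for i j
    using GLD(1)[OF UV(1)] that by (auto simp: mats_def)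
  have WO: "W $$ (i, j) \<in> \<O>" if "i < m" "j < m" for i j
    using GLD(1)[OF W(1)] that by (auto simp: mats_def)
  have nonunit: "W $$ (i, j) \<in> nonunits" if i: "i \<in> ?I" and j: "j < m" "j \<notin> ?J" for i j
  proof -
    \<comment> \<open>Entry (i, j) of both sides of \<open>dW\<close>. For \<open>j \<ge> p\<close>
      the right side has no diagonal entry in column \<open>j\<close>, so the column is
      zero.\<close>
    have ij: "d i * W $$ (i, j) = (if j < p then U $$ (i, j) * e j else 0)"
      using arg_cong[OF dW, of "\<lambda>M. M $$ (i, j)"] i j
        index_rect_diag_mult[OF carr(3), of i p j d] index_mult_rect_diag[OF carr(1), of i j m e]
      by simp
    show ?thesis
    proof (cases "j < p \<and> e j \<noteq> 0")
      \<comment> \<open>As \<open>e j\<close> does not divide \<open>c\<close>, the quotient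
        \<open>e j / c\<close> is a nonunit of the ring; as \<open>d i\<close> divides
        \<open>c\<close>, the entry of \<open>W\<close> is a ring multiple of this nonunit.\<close>
      case True
      with j have ce: "c / e j \<notin> \<O>"
        by auto
      with True quotient_mem_or[of c "e j"] c have "e j / c \<in> nonunits"
        by (auto simp: nonunits_def)
      then have "U $$ (i, j) * (c / d i) * (e j / c) \<in> nonunits"
        using i True by (intro nonunits_mult mult_mem UO) auto
      moreover have "U $$ (i, j) * (c / d i) * (e j / c) = W $$ (i, j)"
        using ij True i c by (simp add: field_simps)
      ultimately show ?thesis
        by simp
    next
      case False
      with ij i have "W $$ (i, j) = 0"
        by (auto split: if_splits)
      then show ?thesis
        by (simp add: nonunits_def zero_mem)
    qed
  qed
  have "signof \<pi> * (\<Prod>i = 0..<m. W $$ (i, \<pi> i)) \<in> nonunits" if \<pi>: "\<pi> permutes {0..<m}" for \<pi>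
  proof -
    \<comment> \<open>Pigeonhole: an injective map cannot send the larger index set into the smaller
      one, so some factor of this Leibniz product is a nonunit.\<close>
    have "\<not> \<pi> ` ?I \<subseteq> ?J"
    proof
      assume "\<pi> ` ?I \<subseteq> ?J"
      then have "card (\<pi> ` ?I) \<le> card ?J"
        by (intro card_mono) auto
      moreover have "card (\<pi> ` ?I) = card ?I"
        using \<pi> by (intro card_image) (meson inj_on_subset permutes_inj subset_UNIV)
      ultimately show False
        using less by simp
    qed
    then obtain i where i: "i \<in> ?I" "\<pi> i \<notin> ?J"
      by blast
    have im: "\<pi> k < m" if "k < m" for k
      using permutes_in_image[OF \<pi>, of k] that by simp
    have "(\<Prod>k = 0..<m. W $$ (k, \<pi> k)) = (\<Prod>k \<in> {0..<m} - {i}. W $$ (k, \<pi> k)) * W $$ (i, \<pi> i)"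
      using i by (subst prod.remove[of _ i]) (auto simp: mult.commute)
    moreover have "(\<Prod>k \<in> {0..<m} - {i}. W $$ (k, \<pi> k)) \<in> \<O>"
      by (intro prod_mem WO im) auto
    ultimately show ?thesis
      using nonunits_mult[OF signof_mem nonunits_mult[OF _ nonunit[OF i(1) im i(2)]]] i(1) by auto
  qed
  then have "det W \<in> nonunits"
    unfolding det_def'[OF carr(3)] by (intro nonunits_sum) auto
  with GL_det[OF W(1)] show False
    by (simp add: nonunits_def)
qed

text \<open>Both inequalities by symmetry of the equivalence. Letting \<open>c\<close> vary turns
  these counts into an invariant that recovers the diagonal up to order and units.\<close>

lemma card_dividing_diag_eq:
  assumes "equivalent p m (rect_diag p m d) (rect_diag p m e)" and "c \<noteq> 0"
  shows "card {i. i < min p m \<and> d i \<noteq> 0 \<and> c / d i \<in> \<O>}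
    = card {i. i < min p m \<and> e i \<noteq> 0 \<and> c / e i \<in> \<O>}"
  by (intro antisym card_dividing_diag_le assms equivalent_sym)

section \<open>Existence of the Smith form\<close>

text \<open>Divisibility is a total preorder in a valuation ring. When a new element is not
  divisible by the old divisor, it divides that divisor and thus everything else.\<close>

lemma exists_common_divisor:
  "finite S \<Longrightarrow> S \<noteq> {} \<Longrightarrow> 0 \<notin> S \<Longrightarrow> \<exists>g \<in> S. \<forall>a \<in> S. a / g \<in> \<O>"
proof (induction S rule: finite_ne_induct)
  case (singleton a)
  then show ?case
    by (auto simp: one_mem)
next
  case (insert b S)
  then obtain g where g: "g \<in> S" "\<forall>a \<in> S. a / g \<in> \<O>"
    by auto
  show ?case
  proof (cases "b / g \<in> \<O>")
    case True
    with g show ?thesis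
      by auto
  next
    case False
    then have gb: "g / b \<in> \<O>"
      using quotient_mem_or by blast
    have "a / b \<in> \<O>" if "a \<in> S" for a
    proof -
      have "(a / g) * (g / b) \<in> \<O>"
        using g that gb by (intro mult_mem) auto
      moreover have "g \<noteq> 0"
        using g insert.prems by auto
      ultimately show ?thesis
        by simp
    qed
    then show ?thesis
      using insert.prems by (auto simp: one_mem)
  qed
qed

text \<open>One step of Gaussian elimination, with the Schur complement of \<open>g\<close> as
  remaining block. The multipliers \<open>b\<close> and \<open>c\<close> lie in the ring because
  \<open>g\<close> divides its row and column; the entries of \<open>M\<close> themselves may lie
  outside.\<close>

lemma equivalent_pivot:
  assumes M: "M \<in> carrier_mat (Suc p) (Suc m)" and g: "M $$ (0, 0) = g" "g \<noteq> 0"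
    and div: "\<And>i j. i \<le> p \<Longrightarrow> j \<le> m \<Longrightarrow> M $$ (i, j) / g \<in> \<O>"
  shows "equivalent (Suc p) (Suc m) M (block_diag (mat 1 1 (\<lambda>_. g))
    (mat p m (\<lambda>(i, j). M $$ (Suc i, Suc j) - M $$ (Suc i, 0) * M $$ (0, Suc j) / g)))"
    (is "equivalent _ _ _ (block_diag ?g ?D)")
proof -
  define b where "b = mat 1 m (\<lambda>(i, j). M $$ (0, Suc j) / g)"
  define c where "c = mat p 1 (\<lambda>(i, j). M $$ (Suc i, 0) / g)"
  have carr: "b \<in> carrier_mat 1 m" "c \<in> carrier_mat p 1" "?g \<in> carrier_mat 1 1" "?D \<in> carrier_mat p m"
    by (simp_all add: b_def c_def)
  have L: "four_block_mat (1\<^sub>m 1) (0\<^sub>m 1 p) c (1\<^sub>m p) \<in> GL (1 + p)"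
    by (rule GL_lower_unitriangular) (auto simp: mats_def c_def intro!: div)
  have R: "four_block_mat (1\<^sub>m 1) b (0\<^sub>m m 1) (1\<^sub>m m) \<in> GL (1 + m)"
    by (rule GL_upper_unitriangular) (auto simp: mats_def b_def intro!: div)
  have "four_block_mat (1\<^sub>m 1) (0\<^sub>m 1 p) c (1\<^sub>m p) * block_diag ?g ?D
      = four_block_mat ?g (0\<^sub>m 1 m) (c * ?g) ?D"
    using carr by (simp add: mult_four_block_mat[of _ 1 1 _ p _ p _ _ 1 _ m])
  moreover have "four_block_mat ?g (0\<^sub>m 1 m) (c * ?g) ?D * four_block_mat (1\<^sub>m 1) b (0\<^sub>m m 1) (1\<^sub>m m)
      = four_block_mat ?g (?g * b) (c * ?g) (c * ?g * b + ?D)"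
    using carr mult_carrier_mat[OF carr(2,3)] right_add_zero_mat[OF mult_carrier_mat[OF carr(3,1)]]
    by (simp add: mult_four_block_mat[of _ 1 1 _ m _ p _ _ 1 _ m])
  moreover have "four_block_mat ?g (?g * b) (c * ?g) (c * ?g * b + ?D) = M"
    using M g by (intro eq_matI) (auto simp: b_def c_def scalar_prod_def not_less gr0_conv_Suc less_Suc_eq_0_disj)
  ultimately have "M = four_block_mat (1\<^sub>m 1) (0\<^sub>m 1 p) c (1\<^sub>m p) * block_diag ?g ?D
      * four_block_mat (1\<^sub>m 1) b (0\<^sub>m m 1) (1\<^sub>m m)"
    by (simp only:)
  moreover have "block_diag ?g ?D \<in> carrier_mat (1 + p) (1 + m)"
    using carr by (intro four_block_carrier_mat)
  ultimately show ?thesis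
    using equivalentI[OF L R] unfolding plus_1_eq_Suc by blast
qed

lemma equivalent_swap:
  assumes M: "M \<in> carrier_mat p m" and kl: "k < p" "k' < p" "l < m" "l' < m"
  shows "equivalent p m M (swapcols l l' (swaprows k k' M))"
proof -
  have "swapcols l l' (swaprows k k' M) = swaprows k k' M * swaprows_mat m l l'"
    using M kl by (intro swapcols_mat) auto
  also have "\<dots> = swaprows_mat p k k' * M * swaprows_mat m l l'"
    by (simp only: swaprows_mat[OF M kl(1,2)])
  finally show ?thesis
    using equivalentI[OF GL_swaprows_mat[OF kl(1,2)] GL_swaprows_mat[OF kl(3,4)] M]
    by (intro equivalent_sym[of p m _ M])
qed

text \<open>Induction on the number of rows, pivoting on an entry that divides all others. The last
  clause serves the induction: taken at the pivot, it shows that the pivot divides the diagonal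
  found for the Schur complement, which extends the divisibility chain. Where
  \<open>f i = 0\<close>, the quotient \<open>f j / f i\<close> is 0 by convention and the chain
  condition holds.\<close>

lemma smith_form:
  assumes "G \<in> carrier_mat p m"
  shows "\<exists>f r. equivalent p m G (rect_diag p m f) \<and> r \<le> p \<and> r \<le> m \<and>
    (\<forall>i < r. f i \<noteq> 0) \<and> (\<forall>i \<ge> r. f i = 0) \<and> (\<forall>i j. i \<le> j \<longrightarrow> f j / f i \<in> \<O>) \<and>
    (\<forall>h. h \<noteq> 0 \<longrightarrow> (\<forall>i < p. \<forall>j < m. G $$ (i, j) / h \<in> \<O>) \<longrightarrow> (\<forall>i. f i / h \<in> \<O>))"
  using assms
proof (induction p arbitrary: m G)
  case 0
  then show ?case
    by (intro exI[of _ "\<lambda>_. 0"] exI[of _ 0] conjI allI impI equivalentI[OF GL_one GL_one])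
       (auto simp: zero_mem)
next
  case (Suc p)
  show ?case
  proof (cases "\<forall>i < Suc p. \<forall>j < m. G $$ (i, j) = 0")
    case True
    then have "G = rect_diag (Suc p) m (\<lambda>_. 0)"
      using Suc.prems by (intro eq_matI) auto
    then show ?thesis
      using Suc.prems by (intro exI[of _ "\<lambda>_. 0"] exI[of _ 0]) (auto simp: zero_mem intro: equivalent_refl)
  next
    case False
    define S where "S = {G $$ (i, j) | i j. i < Suc p \<and> j < m \<and> G $$ (i, j) \<noteq> 0}"
    have "S \<subseteq> (\<lambda>(i, j). G $$ (i, j)) ` ({..<Suc p} \<times> {..<m})"
      by (auto simp: S_def)
    then have "finite S"
      by (rule finite_subset) auto
    then obtain g where g: "g \<in> S" "\<forall>a \<in> S. a / g \<in> \<O>"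
      using exists_common_divisor[of S] False by (auto simp: S_def)
    then obtain k l where kl: "k < Suc p" "l < m" "G $$ (k, l) = g" "g \<noteq> 0"
      by (auto simp: S_def)
    have div: "G $$ (i, j) / g \<in> \<O>" if "i < Suc p" "j < m" for i j
      using g that by (cases "G $$ (i, j) = 0") (auto simp: S_def zero_mem)
    obtain m' where m: "m = Suc m'"
      using kl by (cases m) auto
    \<comment> \<open>The chosen divisor is moved to the top left corner; up to position the entries
      are those of \<open>G\<close>, so it still divides all of them.\<close>
    define M where "M = swapcols 0 l (swaprows 0 k G)"
    have GM: "equivalent (Suc p) m G M"
      unfolding M_def using Suc.prems kl by (intro equivalent_swap) auto
    have M: "M \<in> carrier_mat (Suc p) (Suc m')"
      using equivalent_carrier(2)[OF GM] by (simp add: m)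
    have entries: "\<exists>i' < Suc p. \<exists>j' < m. M $$ (i, j) = G $$ (i', j')" if "i < Suc p" "j < m" for i j
      using that Suc.prems kl by (auto simp: M_def m)
    have M0: "M $$ (0, 0) = g"
      using Suc.prems kl by (auto simp: M_def m)
    have divM: "M $$ (i, j) / g \<in> \<O>" if "i \<le> p" "j \<le> m'" for i j
      using entries[of i j] div that by (auto simp: m less_Suc_eq_le)
    define D where "D = mat p m' (\<lambda>(i, j). M $$ (Suc i, Suc j) - M $$ (Suc i, 0) * M $$ (0, Suc j) / g)"
    have MD: "equivalent (Suc p) (Suc m') M (block_diag (mat 1 1 (\<lambda>_. g)) D)"
      unfolding D_def using M M0 kl(4) divM by (rule equivalent_pivot)
    have D: "D \<in> carrier_mat p m'"
      by (simp add: D_def)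
    have divD: "D $$ (i, j) / g \<in> \<O>" if "i < p" "j < m'" for i j
    proof -
      have "M $$ (Suc i, Suc j) / g + - ((M $$ (Suc i, 0) / g) * (M $$ (0, Suc j) / g)) \<in> \<O>"
        using that by (intro add_mem minus_mem mult_mem divM) auto
      then show ?thesis
        using that by (simp add: D_def diff_divide_distrib)
    qed
    \<comment> \<open>The last fact comes from the final clause of the induction hypothesis with
      \<open>h = g\<close>, justified by \<open>divD\<close>.\<close>
    obtain f r where f: "equivalent p m' D (rect_diag p m' f)" "r \<le> p" "r \<le> m'"
      "\<forall>i < r. f i \<noteq> 0" "\<forall>i \<ge> r. f i = 0" "\<forall>i j. i \<le> j \<longrightarrow> f j / f i \<in> \<O>" "\<forall>i. f i / g \<in> \<O>"
      using Suc.IH[OF D] divD kl(4) by metis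
    define f' where "f' = case_nat g f"
    have diag: "block_diag (mat 1 1 (\<lambda>_. g)) (rect_diag p m' f) = rect_diag (Suc p) (Suc m') f'"
      by (intro eq_matI) (auto simp: f'_def split: nat.split)
    have "equivalent (1 + p) (1 + m') (block_diag (mat 1 1 (\<lambda>_. g)) D)
        (block_diag (mat 1 1 (\<lambda>_. g)) (rect_diag p m' f))"
      by (intro equivalent_block_diag equivalent_refl f(1)) simp
    then have eq: "equivalent (Suc p) m G (rect_diag (Suc p) m f')"
      using equivalent_trans[OF GM] equivalent_trans[OF MD] unfolding diag m by simp
    show ?thesis
    proof (intro exI[of _ f'] exI[of _ "Suc r"] conjI allI impI)
      show "equivalent (Suc p) m G (rect_diag (Suc p) m f')"
        by (fact eq)
      show "Suc r \<le> Suc p" "Suc r \<le> m"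
        using f m by auto
      show "f' i \<noteq> 0" if "i < Suc r" for i
        using that f kl by (auto simp: f'_def split: nat.split)
      show "f' i = 0" if "Suc r \<le> i" for i
        using that f by (auto simp: f'_def split: nat.split)
      show "f' j / f' i \<in> \<O>" if "i \<le> j" for i j
        using that f kl by (auto simp: f'_def one_mem split: nat.split)
      fix h i
      assume h: "h \<noteq> 0" "\<forall>i < Suc p. \<forall>j < m. G $$ (i, j) / h \<in> \<O>"
      then have "g / h \<in> \<O>"
        using kl by auto
      moreover have "f n / h \<in> \<O>" for n
        using mult_mem[of "f n / g" "g / h"] f(7) \<open>g / h \<in> \<O>\<close> kl(4) by simp
      ultimately show "f' i / h \<in> \<O>"
        by (auto simp: f'_def split: nat.split)
    qed
  qed
qed

end

text \<open>A field is a valuation ring in itself, so \<open>M\<close> is diagonal up to invertible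
  factors. Full row or column rank means that the diagonal has no zero in that direction, and the
  transposed diagonal of reciprocals inverts it on the corresponding side.\<close>

lemma full_rank_one_sided_inverse:
  fixes M :: "'a :: field mat"
  assumes M: "M \<in> carrier_mat p q"
  shows "mat_rank M = p \<Longrightarrow> \<exists>L \<in> carrier_mat q p. M * L = 1\<^sub>m p"
    and "mat_rank M = q \<Longrightarrow> \<exists>L \<in> carrier_mat q p. L * M = 1\<^sub>m q"
proof -
  interpret valuation_ring "UNIV :: 'a set"
    by unfold_locales auto
  obtain f r where fr: "equivalent p q M (rect_diag p q f)" "r \<le> p" "r \<le> q"
    "\<forall>i < r. f i \<noteq> 0" "\<forall>i \<ge> r. f i = 0"
    using smith_form[OF M] by blast
  obtain U V where UV: "U \<in> GL p" "V \<in> GL q" "M = U * rect_diag p q f * V"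
    using fr(1) by (auto simp: equivalent_def)
  have rank: "mat_rank M = r"
    using fr by (intro mat_rank_of_rect_diag[OF UV]) auto
  obtain U' where U': "U' \<in> GL p" "U * U' = 1\<^sub>m p" "U' * U = 1\<^sub>m p"
    using UV(1) by (rule GL_inverse)
  obtain V' where V': "V' \<in> GL q" "V * V' = 1\<^sub>m q" "V' * V = 1\<^sub>m q"
    using UV(2) by (rule GL_inverse)
  note c = GLD(2)[OF UV(1)] GLD(2)[OF UV(2)] GLD(2)[OF U'(1)] GLD(2)[OF V'(1)]
  define E where "E = rect_diag q p (\<lambda>i. inverse (f i))"
  define L where "L = V' * E * U'"
  have E: "E \<in> carrier_mat q p"
    by (simp add: E_def)
  have L: "L \<in> carrier_mat q p"
    unfolding L_def by (rule mult_carrier_mat[OF mult_carrier_mat[OF c(4) E] c(3)])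
  {
    assume "mat_rank M = p"
    then have "rect_diag p q f * E = 1\<^sub>m p"
      unfolding E_def rect_diag_mult one_mat_rect_diag using fr rank by (intro rect_diag_cong) auto
    then have "M * L = 1\<^sub>m p"
      unfolding L_def UV(3) mult_cancel_middle[OF c(1) rect_diag_carrier c(2,4) E c(3) V'(2)]
      using c U' by simp
    with L show "\<exists>L \<in> carrier_mat q p. M * L = 1\<^sub>m p"
      by blast
  next
    assume "mat_rank M = q"
    then have "E * rect_diag p q f = 1\<^sub>m q"
      unfolding E_def rect_diag_mult one_mat_rect_diag using fr rank by (intro rect_diag_cong) auto
    then have "L * M = 1\<^sub>m q"
      unfolding L_def UV(3) mult_cancel_middle[OF c(4) E c(3,1) rect_diag_carrier c(2) U'(3)]
      using c V' by simp
    with L show "\<exists>L \<in> carrier_mat q p. L * M = 1\<^sub>m q"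
      by blast
  }
qed

section \<open>System matrices over a valuation ring\<close>

context valuation_ring
begin

lemma equivalent_of_mult_eq:
  assumes "M \<in> carrier_mat p m" "H \<in> carrier_mat p m" "U \<in> GL p" "V \<in> GL m" "M * V = U * H"
  shows "equivalent p m M H"
proof -
  obtain V' where V': "V' \<in> GL m" "V * V' = 1\<^sub>m m"
    using assms(4) by (rule GL_inverse)
  have "M = M * (V * V')"
    using assms V' by simp
  also have "\<dots> = M * V * V'"
    by (rule assoc_mult_mat[OF assms(1) GLD(2)[OF assms(4)] GLD(2)[OF V'(1)], symmetric])
  finally show ?thesis
    using assms V' by (intro equivalentI[of U _ V']) auto
qed

lemma lower_unitriangular_mult_block_diag:
  assumes "F \<in> carrier_mat p n" "N \<in> carrier_mat p m"
  shows "four_block_mat (1\<^sub>m n) (0\<^sub>m n p) F (1\<^sub>m p) * block_diag (1\<^sub>m n) (N :: 'a mat)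
    = four_block_mat (1\<^sub>m n) (0\<^sub>m n m) F N"
  using assms by (simp add: mult_four_block_mat[of _ n n _ p _ p _ _ n _ m])

lemma lower_unitriangular_uminus_mult:
  assumes "F \<in> carrier_mat p n" "N \<in> carrier_mat p m"
  shows "four_block_mat (1\<^sub>m n) (0\<^sub>m n p) (- F) (1\<^sub>m p) * four_block_mat (1\<^sub>m n) (0\<^sub>m n m) F (N :: 'a mat)
    = block_diag (1\<^sub>m n) N"
  using assms uminus_l_inv_mat[of F p n] by (simp add: mult_four_block_mat[of _ n n _ p _ p _ _ n _ m])

text \<open>The case of a diagonal transfer matrix. \<open>J\<close> is the inverse of
  \<open>A\<close> over the field and may have entries outside the ring. \<open>?N\<close> holds the
  numerators and \<open>?E\<close> the denominators; \<open>?E\<close> is \<open>m\<close> by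
  \<open>m\<close>, so it is filled with 1 where \<open>g i\<close> is not an entry of the transfer
  matrix.\<close>

lemma equivalent_of_diagonal_transfer:
  assumes A: "A \<in> mats n n" and B: "B \<in> mats n m" and C: "C \<in> mats p n" and D: "D \<in> mats p m"
    and J: "J \<in> carrier_mat n n" "A * J = 1\<^sub>m n"
    and X: "X \<in> mats n n" and Y: "Y \<in> mats m n" and XY: "A * X + B * Y = 1\<^sub>m n"
    and Z: "Z \<in> mats n n" and W: "W \<in> mats n p" and ZW: "Z * A + W * C = 1\<^sub>m n"
    and g: "D + C * J * B = rect_diag p m g"
  shows "equivalent (n + p) (n + m) (four_block_mat A B (- C) D)
      (block_diag (1\<^sub>m n) (rect_diag p m (\<lambda>i. if g i \<in> \<O> then g i else 1)))"
    (is "equivalent _ _ ?P (block_diag _ ?N)")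
    and "equivalent (n + m) (n + m) (block_diag A (1\<^sub>m m))
      (block_diag (1\<^sub>m n) (rect_diag m m (\<lambda>i. if i < p \<and> g i \<notin> \<O> then inverse (g i) else 1)))"
    (is "equivalent _ _ _ (block_diag _ ?E)")
proof -
  \<comment> \<open>Bezout coefficients: at every index one of numerator and denominator is 1.
    \<open>a\<close> selects the indices where \<open>?E\<close> is 1, and \<open>b\<close> the
    others, where \<open>?N\<close> is 1.\<close>
  define a where "a = rect_diag m m (\<lambda>i. if i < p \<and> g i \<notin> \<O> then 0 else 1 :: 'a)"
  define b where "b = rect_diag m p (\<lambda>i. if g i \<notin> \<O> then 1 else 0 :: 'a)"
  have N: "?N \<in> mats p m"
    by (rule mats_rect_diag) (auto simp: one_mem)
  have E: "?E \<in> mats m m"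
    using mem_or_inverse_mem by (intro mats_rect_diag) (auto simp: one_mem)
  have a: "a \<in> mats m m" and b: "b \<in> mats m p"
    unfolding a_def b_def by (auto intro!: mats_rect_diag simp: one_mem zero_mem)
  have bezout: "a * ?E + b * ?N = 1\<^sub>m m"
    unfolding a_def b_def rect_diag_mult by (intro eq_matI) auto
  \<comment> \<open>An entry outside the ring is nonzero, because \<open>0 \<in> \<O>\<close>, so it
    cancels against its inverse.\<close>
  have gE: "rect_diag p m g * ?E = ?N"
    unfolding rect_diag_mult by (rule rect_diag_cong) (use zero_mem in \<open>auto intro!: right_inverse\<close>)
  note carr = A[THEN matsD] B[THEN matsD] C[THEN matsD] D[THEN matsD] X[THEN matsD] Y[THEN matsD]
    Z[THEN matsD] W[THEN matsD] N[THEN matsD] E[THEN matsD] a[THEN matsD] b[THEN matsD] J(1)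
  note BE = mult_carrier_mat[OF carr(2) carr(10)]
  \<comment> \<open>At first \<open>S\<close> is only a matrix over the field. It is chosen so that
    \<open>A * S + B * ?E = 0\<close>, and then \<open>- C * S + D * ?E\<close> is the transfer
    matrix times \<open>?E\<close>, that is \<open>?N\<close>.\<close>
  define S where "S = - (J * (B * ?E))"
  have Sc: "S \<in> carrier_mat n m"
    unfolding S_def by (intro uminus_carrier_mat mult_carrier_mat[OF J(1) BE])
  have "A * (J * (B * ?E)) = A * J * (B * ?E)"
    by (rule assoc_mult_mat[OF carr(1) J(1) BE, symmetric])
  then have AS: "A * S = - (B * ?E)"
    unfolding S_def using carr BE J mult_carrier_mat[OF J(1) BE] by simp
  have "C * (J * (B * ?E)) = C * J * (B * ?E)"
    by (rule assoc_mult_mat[OF carr(3) J(1) BE, symmetric])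
  also have "\<dots> = C * J * B * ?E"
    by (rule assoc_mult_mat[OF mult_carrier_mat[OF carr(3) J(1)] carr(2,10), symmetric])
  finally have CJBE: "C * (J * (B * ?E)) = C * J * B * ?E" .
  note CJB = mult_carrier_mat[OF mult_carrier_mat[OF carr(3) J(1)] carr(2)]
  have "?N = D * ?E + C * J * B * ?E"
    unfolding gE[symmetric] g[symmetric] by (rule add_mult_distrib_mat[OF carr(4) CJB carr(10)])
  moreover have "- C * S = C * J * B * ?E"
    unfolding S_def CJBE[symmetric] using carr BE J mult_carrier_mat[OF J(1) BE] by simp
  ultimately have CS: "- C * S + D * ?E = ?N"
    by (simp only: comm_add_mat[OF mult_carrier_mat[OF CJB carr(10)] mult_carrier_mat[OF carr(4,10)]])
  have S: "S \<in> mats n m"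
  proof -
    have CSc: "C * S \<in> carrier_mat p m" and DEc: "D * ?E \<in> carrier_mat p m"
      using mult_carrier_mat[OF carr(3) Sc] mult_carrier_mat[OF carr(4,10)] by blast+
    have "C * S = D * ?E + - ?N"
      unfolding CS[symmetric] using CSc DEc carr Sc by (intro eq_matI) auto
    then have CS_mem: "C * S \<in> mats p m"
      using mats_add[OF mats_mult[OF D E] mats_uminus[OF N]] by simp
    have AS_mem: "A * S \<in> mats n m"
      unfolding AS by (rule mats_uminus[OF mats_mult[OF B E]])
    \<comment> \<open>The identity \<open>ZW\<close> enters here: it expresses \<open>S\<close>
      through \<open>A * S\<close> and \<open>C * S\<close>, both already known to lie over the
      ring.\<close>
    have "S = (Z * A + W * C) * S"
      using Sc ZW by simp
    also have "\<dots> = Z * A * S + W * C * S"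
      by (rule add_mult_distrib_mat[OF mult_carrier_mat[OF carr(7,1)] mult_carrier_mat[OF carr(8,3)] Sc])
    also have "Z * A * S = Z * (A * S)"
      by (rule assoc_mult_mat[OF carr(7,1) Sc])
    also have "W * C * S = W * (C * S)"
      by (rule assoc_mult_mat[OF carr(8,3) Sc])
    finally show ?thesis
      using mats_add[OF mats_mult[OF Z AS_mem] mats_mult[OF W CS_mem]] by simp
  qed
  \<comment> \<open>The lower left block of \<open>?P * V\<close>; over the ring it is cleared by a
    unitriangular factor.\<close>
  define F where "F = - C * X + D * Y"
  have F: "F \<in> mats p n"
    unfolding F_def by (intro mats_add mats_mult[OF _ X] mats_mult[OF D Y] mats_uminus C)
  note Fc = matsD[OF F]
  define V where "V = four_block_mat X S Y ?E"
  have V: "V \<in> mats (n + m) (n + m)"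
    unfolding V_def by (intro mats_four_block X S Y E)
  define K where "K = four_block_mat A B (0\<^sub>m m n) (1\<^sub>m m)"
  have P: "?P \<in> mats (n + p) (n + m)" and K: "K \<in> mats (n + m) (n + m)"
    unfolding K_def by (intro mats_four_block A B C D mats_uminus mats_zero mats_one)+
  have BEAS: "A * S + B * ?E = 0\<^sub>m n m"
    unfolding AS using BE by simp
  have PV: "?P * V = four_block_mat (1\<^sub>m n) (0\<^sub>m n m) F ?N"
    unfolding V_def using carr Sc
    by (subst mult_four_block_mat[of _ n n _ m _ p _ _ n _ m]) (simp_all only: XY BEAS CS F_def uminus_carrier_iff_mat)
  have KV: "K * V = four_block_mat (1\<^sub>m n) (0\<^sub>m n m) Y ?E"
    unfolding V_def K_def using carr Sc XY BEAS
    by (simp add: mult_four_block_mat[of _ n n _ m _ m _ _ n _ m])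
  let ?L = "\<lambda>q F. four_block_mat (1\<^sub>m n) (0\<^sub>m n q) F (1\<^sub>m q)"
  have LF: "?L p F \<in> GL (n + p)" and LF': "?L p (- F) \<in> GL (n + p)"
    by (intro GL_lower_unitriangular mats_uminus F)+
  have LY: "?L m Y \<in> GL (n + m)" and LY': "?L m (- Y) \<in> GL (n + m)"
    by (intro GL_lower_unitriangular mats_uminus Y)+
  have LPV: "?L p (- F) * ?P * V = block_diag (1\<^sub>m n) ?N"
    unfolding lower_unitriangular_uminus_mult[OF Fc carr(9), symmetric] PV[symmetric]
    by (rule assoc_mult_mat[OF GLD(2)[OF LF'] matsD[OF P] matsD[OF V]])
  have LKV: "?L m (- Y) * K * V = block_diag (1\<^sub>m n) ?E"
    unfolding lower_unitriangular_uminus_mult[OF carr(6,10), symmetric] KV[symmetric]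
    by (rule assoc_mult_mat[OF GLD(2)[OF LY'] matsD[OF K] matsD[OF V]])
  define Q1 where "Q1 = block_diag (1\<^sub>m n) a"
  define Q2 where "Q2 = block_diag (0\<^sub>m n n) b"
  \<comment> \<open>A left inverse of \<open>V\<close> built from the two diagonal products:
    \<open>Q1\<close> weights \<open>diag(I, E)\<close> by \<open>a\<close> and \<open>Q2\<close>
    weights \<open>diag(I, N)\<close> by \<open>b\<close>. The zero block in \<open>Q2\<close> keeps
    the leading identity from being counted twice.\<close>
  define Q where "Q = Q1 * (?L m (- Y) * K) + Q2 * (?L p (- F) * ?P)"
  have Q1: "Q1 \<in> mats (n + m) (n + m)" and Q2: "Q2 \<in> mats (n + m) (n + p)"
    unfolding Q1_def Q2_def using carr by (auto intro!: mats_four_block mats_zero mats_one a b)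
  note LK = mats_mult[OF GLD(1)[OF LY'] K] and LP = mats_mult[OF GLD(1)[OF LF'] P]
  have Q: "Q \<in> mats (n + m) (n + m)"
    unfolding Q_def by (intro mats_add mats_mult[OF Q1 LK] mats_mult[OF Q2 LP])
  have "Q * V = Q1 * (?L m (- Y) * K) * V + Q2 * (?L p (- F) * ?P) * V"
    unfolding Q_def
    by (rule add_mult_distrib_mat[OF matsD[OF mats_mult[OF Q1 LK]] matsD[OF mats_mult[OF Q2 LP]] matsD[OF V]])
  also have "Q1 * (?L m (- Y) * K) * V = Q1 * block_diag (1\<^sub>m n) ?E"
    unfolding LKV[symmetric] by (rule assoc_mult_mat[OF matsD[OF Q1] matsD[OF LK] matsD[OF V]])
  also have "Q2 * (?L p (- F) * ?P) * V = Q2 * block_diag (1\<^sub>m n) ?N"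
    unfolding LPV[symmetric] by (rule assoc_mult_mat[OF matsD[OF Q2] matsD[OF LP] matsD[OF V]])
  also have "Q1 * block_diag (1\<^sub>m n) ?E = block_diag (1\<^sub>m n) (a * ?E)"
    unfolding Q1_def
    by (subst block_diag_mult[OF one_carrier_mat one_carrier_mat carr(11,10)]) simp
  also have "Q2 * block_diag (1\<^sub>m n) ?N = block_diag (0\<^sub>m n n) (b * ?N)"
    unfolding Q2_def
    by (subst block_diag_mult[OF zero_carrier_mat one_carrier_mat carr(12,9)]) simp
  also have "block_diag (1\<^sub>m n) (a * ?E) + block_diag (0\<^sub>m n n) (b * ?N)
      = four_block_mat (1\<^sub>m n) (0\<^sub>m n m) (0\<^sub>m m n) (a * ?E + b * ?N)"
    using carr(11,12) mult_carrier_mat[OF carr(11,10)] mult_carrier_mat[OF carr(12,9)]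
    by (intro eq_matI) auto
  finally have "Q * V = 1\<^sub>m (n + m)"
    by (simp only: bezout four_block_one_mat)
  then have V_GL: "V \<in> GL (n + m)"
    by (rule GL_I(2)[OF Q V])
  have PVL: "?P * V = ?L p F * block_diag (1\<^sub>m n) ?N"
    unfolding PV by (rule lower_unitriangular_mult_block_diag[OF Fc carr(9), symmetric])
  show "equivalent (n + p) (n + m) ?P (block_diag (1\<^sub>m n) ?N)"
    by (rule equivalent_of_mult_eq[OF matsD[OF P] four_block_carrier_mat[OF one_carrier_mat carr(9)] LF V_GL PVL])
  have "K * V = ?L m Y * block_diag (1\<^sub>m n) ?E"
    unfolding KV by (rule lower_unitriangular_mult_block_diag[OF carr(6,10), symmetric])
  then have "equivalent (n + m) (n + m) K (block_diag (1\<^sub>m n) ?E)"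
    by (rule equivalent_of_mult_eq[OF matsD[OF K] four_block_carrier_mat[OF one_carrier_mat carr(10)] LY V_GL])
  \<comment> \<open>\<open>K\<close> is \<open>diag(A, I)\<close> multiplied on the left by a
    unitriangular matrix with the block \<open>B\<close>.\<close>
  moreover have "equivalent (n + m) (n + m) K (block_diag A (1\<^sub>m m))"
  proof (rule equivalentI[OF GL_upper_unitriangular[OF B] GL_one])
    show *: "block_diag A (1\<^sub>m m) \<in> carrier_mat (n + m) (n + m)"
      by (rule four_block_carrier_mat[OF carr(1) one_carrier_mat])
    have "four_block_mat (1\<^sub>m n) B (0\<^sub>m m n) (1\<^sub>m m) * block_diag A (1\<^sub>m m) = K"
      unfolding K_def using carr by (simp add: mult_four_block_mat[of _ n n _ m _ m _ _ n _ m])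
    then show "K = four_block_mat (1\<^sub>m n) B (0\<^sub>m m n) (1\<^sub>m m) * block_diag A (1\<^sub>m m) * 1\<^sub>m (n + m)"
      using matsD[OF K] by simp
  qed
  ultimately show "equivalent (n + m) (n + m) (block_diag A (1\<^sub>m m)) (block_diag (1\<^sub>m n) ?E)"
    using equivalent_sym equivalent_trans by blast
qed

text \<open>Multiplying the system matrix by \<open>diag(I, U)\<close> and \<open>diag(I, V)\<close>
  keeps \<open>A\<close> and changes the transfer matrix \<open>T\<close> into \<open>U T V\<close>,
  which is diagonal for suitable \<open>U\<close> and \<open>V\<close>. The identities
  \<open>XY\<close> and \<open>ZW\<close> survive with \<open>V' * Y\<close> and
  \<open>W * U'\<close> in place of \<open>Y\<close> and \<open>W\<close>.\<close>

lemma equivalent_of_transfer: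
  assumes A: "A \<in> mats n n" and B: "B \<in> mats n m" and C: "C \<in> mats p n" and D: "D \<in> mats p m"
    and J: "J \<in> carrier_mat n n" "A * J = 1\<^sub>m n"
    and X: "X \<in> mats n n" and Y: "Y \<in> mats m n" and XY: "A * X + B * Y = 1\<^sub>m n"
    and Z: "Z \<in> mats n n" and W: "W \<in> mats n p" and ZW: "Z * A + W * C = 1\<^sub>m n"
    and g: "equivalent p m (D + C * J * B) (rect_diag p m g)"
  shows "equivalent (n + p) (n + m) (four_block_mat A B (- C) D)
      (block_diag (1\<^sub>m n) (rect_diag p m (\<lambda>i. if g i \<in> \<O> then g i else 1)))"
    (is "equivalent _ _ ?P (block_diag _ ?N)")
    and "equivalent (n + m) (n + m) (block_diag A (1\<^sub>m m))
      (block_diag (1\<^sub>m n) (rect_diag m m (\<lambda>i. if i < p \<and> g i \<notin> \<O> then inverse (g i) else 1)))"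
proof -
  obtain U V where UV: "U \<in> GL p" "V \<in> GL m" "rect_diag p m g = U * (D + C * J * B) * V"
    using equivalent_sym[OF g] by (auto simp: equivalent_def)
  obtain U' where U': "U' \<in> GL p" "U' * U = 1\<^sub>m p"
    using UV(1) by (rule GL_inverse)
  obtain V' where V': "V' \<in> GL m" "V * V' = 1\<^sub>m m"
    using UV(2) by (rule GL_inverse)
  note mem = GLD(1)[OF UV(1)] GLD(1)[OF UV(2)] GLD(1)[OF U'(1)] GLD(1)[OF V'(1)]
  note c = mem[THEN matsD]
  note carr = A[THEN matsD] B[THEN matsD] C[THEN matsD] D[THEN matsD] X[THEN matsD] Y[THEN matsD]
    Z[THEN matsD] W[THEN matsD]
  have BY: "B * V * (V' * Y) = B * Y"
  proof -
    have "B * V * (V' * Y) = B * (V * (V' * Y))"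
      by (rule assoc_mult_mat[OF carr(2) c(2) mult_carrier_mat[OF c(4) carr(6)]])
    also have "V * (V' * Y) = V * V' * Y"
      by (rule assoc_mult_mat[OF c(2,4) carr(6), symmetric])
    also have "\<dots> = Y"
      using V' carr by simp
    finally show ?thesis .
  qed
  have WC: "W * U' * (U * C) = W * C"
  proof -
    have "W * U' * (U * C) = W * (U' * (U * C))"
      by (rule assoc_mult_mat[OF carr(8) c(3) mult_carrier_mat[OF c(1) carr(3)]])
    also have "U' * (U * C) = U' * U * C"
      by (rule assoc_mult_mat[OF c(3,1) carr(3), symmetric])
    also have "\<dots> = C"
      using U' carr by simp
    finally show ?thesis .
  qed
  note CJ = mult_carrier_mat[OF carr(3) J(1)]
  have "U * C * J * (B * V) = U * (C * J * B) * V"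
  proof -
    have "U * C * J * (B * V) = U * (C * J) * (B * V)"
      by (simp only: assoc_mult_mat[OF c(1) carr(3) J(1)])
    also have "\<dots> = U * (C * J) * B * V"
      by (rule assoc_mult_mat[OF mult_carrier_mat[OF c(1) CJ] carr(2) c(2), symmetric])
    also have "U * (C * J) * B = U * (C * J * B)"
      by (rule assoc_mult_mat[OF c(1) CJ carr(2)])
    finally show ?thesis .
  qed
  moreover have "rect_diag p m g = U * D * V + U * (C * J * B) * V"
  proof -
    note CJB = mult_carrier_mat[OF CJ carr(2)]
    have "U * (D + C * J * B) = U * D + U * (C * J * B)"
      by (rule mult_add_distrib_mat[OF c(1) carr(4) CJB])
    then show ?thesis
      unfolding UV(3)
      by (simp only: add_mult_distrib_mat[OF mult_carrier_mat[OF c(1) carr(4)] mult_carrier_mat[OF c(1) CJB] c(2)])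
  qed
  ultimately have g': "U * D * V + U * C * J * (B * V) = rect_diag p m g"
    by (simp only:)
  have XY': "A * X + B * V * (V' * Y) = 1\<^sub>m n" and ZW': "Z * A + W * U' * (U * C) = 1\<^sub>m n"
    by (simp_all only: BY WC XY ZW)
  note diagonal = equivalent_of_diagonal_transfer[OF A mats_mult[OF B mem(2)] mats_mult[OF mem(1) C]
      mats_mult[OF mats_mult[OF mem(1) D] mem(2)] J X mats_mult[OF mem(4) Y] XY' Z mats_mult[OF W mem(3)] ZW' g']
  show "equivalent (n + m) (n + m) (block_diag A (1\<^sub>m m))
      (block_diag (1\<^sub>m n) (rect_diag m m (\<lambda>i. if i < p \<and> g i \<notin> \<O> then inverse (g i) else 1)))"
    by (rule diagonal(2))
  let ?P' = "four_block_mat A (B * V) (- (U * C)) (U * D * V)"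
  have "block_diag (1\<^sub>m n) U * ?P * block_diag (1\<^sub>m n) V = ?P'"
  proof -
    have UD: "U * D \<in> carrier_mat p m" and UC: "U * C \<in> carrier_mat p n"
      using mult_carrier_mat[OF c(1)] carr by blast+
    have [simp]: "- 0\<^sub>m n n = (0\<^sub>m n n :: 'a mat)"
      by (intro eq_matI) auto
    have "block_diag (1\<^sub>m n) U * ?P = four_block_mat A B (- (U * C)) (U * D)"
      using c carr UC UD by (simp add: mult_four_block_mat[of _ n n _ p _ p _ _ n _ m])
    also have "\<dots> * block_diag (1\<^sub>m n) V = ?P'"
      using c carr UC UD mult_carrier_mat[OF carr(2) c(2)] mult_carrier_mat[OF UD c(2)]
      by (simp add: mult_four_block_mat[of _ n n _ m _ p _ _ n _ m])
    finally show ?thesis .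
  qed
  then have "equivalent (n + p) (n + m) ?P' ?P"
    using carr
    by (intro equivalentI[OF GL_block_diag[OF GL_one UV(1)] GL_block_diag[OF GL_one UV(2)]]) simp_all
  from equivalent_trans[OF equivalent_sym[OF this] diagonal(1)]
  show "equivalent (n + p) (n + m) ?P (block_diag (1\<^sub>m n) ?N)" .
qed

end

section \<open>The local ring of a point\<close>

lemma no_pole_at_iff: "no_pole_at f x \<longleftrightarrow> (\<exists>a b. poly b x \<noteq> 0 \<and> f = to_fract a / to_fract b)"
  by (auto simp: no_pole_at_def has_value_at_def Fract_conv_to_fract)

lemma to_fract_poly_nonzero: "poly b x \<noteq> 0 \<Longrightarrow> to_fract b \<noteq> 0"
  by auto

lemma no_pole_at_to_fract: "no_pole_at (to_fract a) x"
  unfolding no_pole_at_iff by (intro exI[of _ a] exI[of _ 1]) simp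

lemma to_fract_power: "to_fract (a ^ n) = to_fract a ^ n"
  by (induction n) simp_all

text \<open>All factors \<open>\<lambda> - x\<close> are split off from numerator and denominator;
  what remains vanishes in neither at \<open>x\<close>, so the quotient is a local unit. The
  exponent is the difference of the two orders.\<close>

lemma fract_local_factorization:
  fixes f :: "'a :: field poly fract"
  assumes "f \<noteq> 0"
  obtains k u where "u \<noteq> 0" "no_pole_at u x" "no_pole_at (inverse u) x"
    "f = to_fract [:-x, 1:] powi k * u"
proof -
  let ?t = "[:-x, 1:]"
  obtain a b where f: "f = Fract a b" "b \<noteq> 0"
    by (cases f) auto
  then have "a \<noteq> 0"
    using assms by (auto simp: Fract_conv_to_fract)
  obtain a' where a': "a = ?t ^ order x a * a'" "\<not> ?t dvd a'"
    using order_decomp[OF \<open>a \<noteq> 0\<close>] by blast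
  obtain b' where b': "b = ?t ^ order x b * b'" "\<not> ?t dvd b'"
    using order_decomp[OF f(2)] by blast
  define u where "u = to_fract a' / to_fract b'"
  have nz: "poly a' x \<noteq> 0" "poly b' x \<noteq> 0"
    using a'(2) b'(2) by (simp_all add: poly_eq_0_iff_dvd)
  show ?thesis
  proof
    show "u \<noteq> 0"
      using nz by (auto simp: u_def)
    show "no_pole_at u x" "no_pole_at (inverse u) x"
      unfolding no_pole_at_iff u_def using nz by (auto simp: field_simps)
    have "to_fract a = to_fract ?t ^ order x a * to_fract a'"
      using arg_cong[OF a'(1), of to_fract] by (simp only: to_fract_mult to_fract_power)
    moreover have "to_fract b = to_fract ?t ^ order x b * to_fract b'"
      using arg_cong[OF b'(1), of to_fract] by (simp only: to_fract_mult to_fract_power)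
    ultimately show "f = to_fract ?t powi (int (order x a) - int (order x b)) * u"
      by (simp add: f Fract_conv_to_fract u_def power_int_diff)
  qed
qed

lemma no_pole_at_powi_iff: "no_pole_at (to_fract [:-x, 1:] powi k) x \<longleftrightarrow> k \<ge> 0"
proof
  let ?t = "[:-x, 1:]"
  assume *: "no_pole_at (to_fract ?t powi k) x"
  show "k \<ge> 0"
  proof (rule ccontr)
    assume k: "\<not> k \<ge> 0"
    obtain a b where ab: "poly b x \<noteq> 0" "to_fract ?t powi k = to_fract a / to_fract b"
      using * by (auto simp: no_pole_at_iff)
    have "to_fract ?t powi k = inverse (to_fract ?t ^ nat (- k))"
      using k by (simp add: power_int_def power_inverse)
    with ab have "to_fract b = to_fract (a * ?t ^ nat (- k))"
      by (auto simp: field_simps to_fract_power)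
    \<comment> \<open>For negative \<open>k\<close> the denominator would be a multiple of
      \<open>\<lambda> - x\<close> and vanish at \<open>x\<close>.\<close>
    then have "b = a * ?t ^ nat (- k)"
      by (simp only: to_fract_eq_iff)
    with ab k show False
      by simp
  qed
next
  assume "k \<ge> 0"
  then show "no_pole_at (to_fract [:-x, 1:] powi k) x"
    using no_pole_at_to_fract[of "[:-x, 1:] ^ nat k" x] by (simp add: power_int_def to_fract_power)
qed

text \<open>Once \<open>f\<close> is a power of \<open>\<lambda> - x\<close> times a local unit, the
  sign of the exponent decides which of \<open>f\<close> and \<open>inverse f\<close> has no pole.
  The point stays a parameter of all \<open>local_ring\<close> facts.\<close>

interpretation local_ring: valuation_ring "{f. no_pole_at f x}" for x :: "'a :: field"
proof (unfold_locales, unfold mem_Collect_eq)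
  fix f g :: "'a poly fract"
  show "no_pole_at 1 x"
    using no_pole_at_to_fract[of 1 x] by simp
  show mult: "no_pole_at (f * g) x" if fg: "no_pole_at f x" "no_pole_at g x" for f g :: "'a poly fract"
  proof -
    obtain a b where 1: "poly b x \<noteq> 0" "f = to_fract a / to_fract b"
      using fg by (auto simp: no_pole_at_iff)
    obtain c d where 2: "poly d x \<noteq> 0" "g = to_fract c / to_fract d"
      using fg by (auto simp: no_pole_at_iff)
    show ?thesis
      unfolding no_pole_at_iff using 1 2 by (intro exI[of _ "a * c"] exI[of _ "b * d"]) simp
  qed
  show "no_pole_at (f + g) x" if fg: "no_pole_at f x" "no_pole_at g x"
  proof -
    obtain a b where 1: "poly b x \<noteq> 0" "f = to_fract a / to_fract b"
      using fg by (auto simp: no_pole_at_iff)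
    obtain c d where 2: "poly d x \<noteq> 0" "g = to_fract c / to_fract d"
      using fg by (auto simp: no_pole_at_iff)
    show ?thesis
      unfolding no_pole_at_iff using 1 2 to_fract_poly_nonzero[OF 1(1)] to_fract_poly_nonzero[OF 2(1)]
      by (intro exI[of _ "a * d + c * b"] exI[of _ "b * d"]) (simp add: field_simps)
  qed
  show "no_pole_at (- f) x" if "no_pole_at f x"
    using mult[OF no_pole_at_to_fract[of "- 1" x] that] by simp
  show "no_pole_at f x \<or> no_pole_at (inverse f) x"
  proof (cases "f = 0")
    case True
    then show ?thesis
      using no_pole_at_to_fract[of 0 x] by simp
  next
    case False
    obtain k u where u: "u \<noteq> 0" "no_pole_at u x" "no_pole_at (inverse u) x"
      "f = to_fract [:-x, 1:] powi k * u"
      using False by (rule fract_local_factorization)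
    then have "inverse f = to_fract [:-x, 1:] powi (- k) * inverse u"
      by (simp add: power_int_minus)
    then show ?thesis
      using u mult no_pole_at_powi_iff[of x k] no_pole_at_powi_iff[of x "- k"] by (cases "k \<ge> 0") auto
  qed
qed

section \<open>Invariant orders through equivalence over the local ring\<close>

text \<open>A pole-free determinant is nonzero at \<open>x\<close> exactly if its inverse has no
  pole there, that is, if it is a unit of the local ring.\<close>

lemma regular_at_iff_GL:
  assumes R: "R \<in> carrier_mat n n"
  shows "regular_at R x \<longleftrightarrow> R \<in> local_ring.GL x n"
proof
  assume reg: "regular_at R x"
  then obtain v where v: "v \<noteq> 0" "has_value_at (det R) x v"
    by (auto simp: regular_at_def)
  then obtain a b where ab: "poly b x \<noteq> 0" "det R = to_fract a / to_fract b" "v = poly a x / poly b x"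
    by (auto simp: has_value_at_def Fract_conv_to_fract)
  with v have a: "poly a x \<noteq> 0"
    by auto
  have "R \<in> local_ring.mats x n n"
    using reg R by (auto simp: regular_at_def local_ring.mats_def)
  moreover have "det R \<noteq> 0"
    using a ab by auto
  moreover have "no_pole_at (inverse (det R)) x"
    unfolding no_pole_at_iff using a ab by auto
  ultimately show "R \<in> local_ring.GL x n"
    by (intro local_ring.GL_of_unit_det) auto
next
  assume GL: "R \<in> local_ring.GL x n"
  note det = local_ring.GL_det[OF GL] local_ring.det_mem[OF local_ring.GLD(1)[OF GL]]
  obtain a b where ab: "poly b x \<noteq> 0" "det R = to_fract a / to_fract b"
    using det by (auto simp: no_pole_at_iff)
  obtain c d where cd: "poly d x \<noteq> 0" "inverse (det R) = to_fract c / to_fract d"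
    using det by (auto simp: no_pole_at_iff)
  have "to_fract (a * c) = to_fract (b * d)"
    using ab cd det(1) to_fract_poly_nonzero[OF ab(1)] to_fract_poly_nonzero[OF cd(1)]
    by (simp add: field_simps)
  then have "a * c = b * d"
    by (simp only: to_fract_eq_iff)
  then have "poly a x * poly c x \<noteq> 0"
    using ab cd by (metis mult_eq_0_iff poly_mult)
  then have "poly a x / poly b x \<noteq> 0" "has_value_at (det R) x (poly a x / poly b x)"
    using ab by (auto simp: has_value_at_def Fract_conv_to_fract)
  then have "\<exists>v. v \<noteq> 0 \<and> has_value_at (det R) x v"
    by blast
  moreover have "\<forall>i < n. \<forall>j < n. no_pole_at (R $$ (i, j)) x"
    using local_ring.GLD(1)[OF GL] by (simp add: local_ring.mats_def)
  ultimately show "regular_at R x"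
    using R by (auto simp: regular_at_def)
qed

lemma local_diag_eq_rect_diag:
  "local_diag p m x \<nu>s = rect_diag p m (\<lambda>i. if i < length \<nu>s then to_fract [:-x, 1:] powi (\<nu>s ! i) else 0)"
  by (intro eq_matI) (auto simp: local_diag_def)

lemma is_invariant_orders_iff:
  assumes "G \<in> carrier_mat p m"
  shows "is_invariant_orders G x \<nu>s \<longleftrightarrow>
    sorted \<nu>s \<and> length \<nu>s = mat_rank G \<and> local_ring.equivalent x p m G (local_diag p m x \<nu>s)"
  using assms
  by (auto simp: is_invariant_orders_def local_ring.equivalent_def regular_at_iff_GL local_diag_def
      dest: local_ring.GLD(2))

text \<open>A diagonal entry of order \<nu> divides the \<open>k\<close>-th power of
  \<open>\<lambda> - x\<close> iff \<open>\<nu> \<le> k\<close>, so the invariant counts are the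
  numbers of orders up to \<open>k\<close>. The multiplicity of \<open>k\<close> is the difference
  of the counts at \<open>k\<close> and \<open>k - 1\<close>. The length bounds ensure that every
  listed order occurs on the diagonal.\<close>

lemma mset_eq_of_equivalent_local_diag:
  assumes eq: "local_ring.equivalent x p m (local_diag p m x \<nu>s) (local_diag p m x \<mu>s)"
    and len: "length \<nu>s \<le> min p m" "length \<mu>s \<le> min p m"
  shows "mset \<nu>s = mset \<mu>s"
proof (rule multiset_eqI)
  let ?t = "to_fract [:-x, 1:] :: 'a poly fract"
  have card: "card {i. i < min p m \<and> (if i < length \<xi>s then ?t powi (\<xi>s ! i) else 0) \<noteq> 0 \<and>
      ?t powi k / (if i < length \<xi>s then ?t powi (\<xi>s ! i) else 0) \<in> {f. no_pole_at f x}}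
    = size (filter_mset (\<lambda>\<nu>. \<nu> \<le> k) (mset \<xi>s))" if "length \<xi>s \<le> min p m" for \<xi>s k
  proof -
    have "?t powi k / ?t powi \<nu> = ?t powi (k - \<nu>)" for \<nu>
      by (simp add: power_int_diff)
    then have "{i. i < min p m \<and> (if i < length \<xi>s then ?t powi (\<xi>s ! i) else 0) \<noteq> 0 \<and>
        ?t powi k / (if i < length \<xi>s then ?t powi (\<xi>s ! i) else 0) \<in> {f. no_pole_at f x}}
      = {i. i < length \<xi>s \<and> \<xi>s ! i \<le> k}"
      using that by (auto simp: no_pole_at_powi_iff split: if_splits)
    then show ?thesis
      by (simp add: length_filter_conv_card flip: mset_filter)
  qed
  have size: "size (filter_mset (\<lambda>\<nu>. \<nu> \<le> k) (mset \<nu>s)) = size (filter_mset (\<lambda>\<nu>. \<nu> \<le> k) (mset \<mu>s))" for k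
    using local_ring.card_dividing_diag_eq[OF eq[unfolded local_diag_eq_rect_diag], of "?t powi k"]
    unfolding card[OF len(1)] card[OF len(2)] by simp
  have count: "size (filter_mset (\<lambda>\<nu>. \<nu> \<le> k) M) = count M k + size (filter_mset (\<lambda>\<nu>. \<nu> \<le> k - 1) M)"
    for M :: "int multiset" and k
    by (induction M) auto
  fix k
  show "count (mset \<nu>s) k = count (mset \<mu>s) k"
    using count[of k "mset \<nu>s"] count[of k "mset \<mu>s"] size[of k] size[of "k - 1"] by linarith
qed

text \<open>In the Smith form each nonzero entry is a power of \<open>\<lambda> - x\<close> times a
  unit, and the units move into the right factor. The divisibility chain sorts the
  exponents.\<close>

lemma exists_is_invariant_orders:
  assumes G: "G \<in> carrier_mat p m"
  obtains \<nu>s where "is_invariant_orders G x \<nu>s" "length \<nu>s \<le> min p m"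
proof -
  let ?t = "to_fract [:-x, 1:] :: 'a poly fract"
  obtain f r where fr: "local_ring.equivalent x p m G (rect_diag p m f)" "r \<le> p" "r \<le> m"
    "\<forall>i < r. f i \<noteq> 0" "\<forall>i \<ge> r. f i = 0" "\<forall>i j. i \<le> j \<longrightarrow> no_pole_at (f j / f i) x"
    using local_ring.smith_form[OF G, of x] by auto
  have "\<exists>k u. u \<noteq> 0 \<and> no_pole_at u x \<and> no_pole_at (inverse u) x \<and> f i = ?t powi k * u" if "i < r" for i
    using fr(4) that fract_local_factorization[of "f i" x] by metis
  then obtain \<nu> u where \<nu>: "\<And>i. i < r \<Longrightarrow> u i \<noteq> 0 \<and> no_pole_at (u i) x \<and> no_pole_at (inverse (u i)) x \<and>
      f i = ?t powi (\<nu> i) * u i"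
    by metis
  define \<nu>s where "\<nu>s = map \<nu> [0..<r]"
  \<comment> \<open>The value 1 from \<open>r\<close> on keeps the diagonal matrix of units
    invertible.\<close>
  define w where "w i = (if i < r then u i else 1)" for i
  have mono: "\<nu> i \<le> \<nu> j" if "i \<le> j" "j < r" for i j
  proof -
    have "no_pole_at (f j / f i) x" "no_pole_at (u i) x" "no_pole_at (inverse (u j)) x"
      using fr(6)[rule_format, OF that(1)] \<nu>[of i] \<nu>[of j] that by simp_all
    then have "no_pole_at (f j / f i * u i * inverse (u j)) x"
      by (intro local_ring.mult_mem[of _ x, unfolded mem_Collect_eq])
    moreover have "f j / f i * u i * inverse (u j) = ?t powi (\<nu> j - \<nu> i)"
      using \<nu>[of i] \<nu>[of j] that by (simp add: power_int_diff)
    ultimately show ?thesis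
      using no_pole_at_powi_iff[of x "\<nu> j - \<nu> i"] by simp
  qed
  have W: "rect_diag m m w \<in> local_ring.GL x m"
  proof (rule local_ring.GL_I(1))
    show "rect_diag m m w \<in> local_ring.mats x m m" "rect_diag m m (\<lambda>i. inverse (w i)) \<in> local_ring.mats x m m"
      using \<nu> local_ring.one_mem[of x] by (auto intro!: local_ring.mats_rect_diag simp: w_def)
    show "rect_diag m m w * rect_diag m m (\<lambda>i. inverse (w i)) = 1\<^sub>m m"
      unfolding rect_diag_mult one_mat_rect_diag using \<nu> by (intro rect_diag_cong) (auto simp: w_def)
  qed
  have f: "rect_diag p m f = local_diag p m x \<nu>s * rect_diag m m w"
    unfolding local_diag_eq_rect_diag rect_diag_mult
    using \<nu> fr(5) by (intro rect_diag_cong) (auto simp: \<nu>s_def w_def)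
  have "local_ring.equivalent x p m (rect_diag p m f) (local_diag p m x \<nu>s)"
    using local_ring.equivalentI[OF local_ring.GL_one W, of "local_diag p m x \<nu>s" p]
    by (simp add: f local_diag_def)
  with fr(1) have eq: "local_ring.equivalent x p m G (local_diag p m x \<nu>s)"
    by (rule local_ring.equivalent_trans)
  obtain U V where UV: "U \<in> local_ring.GL x p" "V \<in> local_ring.GL x m" "G = U * rect_diag p m f * V"
    using fr(1) by (auto simp: local_ring.equivalent_def)
  have "mat_rank G = r"
    using fr by (intro local_ring.mat_rank_of_rect_diag[OF UV]) auto
  then have "is_invariant_orders G x \<nu>s"
    unfolding is_invariant_orders_iff[OF G]
    using eq mono by (auto simp: \<nu>s_def sorted_iff_nth_mono)
  then show ?thesis
    using that fr by (auto simp: \<nu>s_def)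
qed

text \<open>Reads the invariant orders off an equivalent local diagonal whose exponents may be in
  any order. Two admissible lists are sorted and share one multiset, so they coincide and
  \<open>THE\<close> is well defined.\<close>

lemma mset_invariant_orders:
  assumes eq: "local_ring.equivalent x p m G (local_diag p m x \<nu>s)" and len: "length \<nu>s \<le> min p m"
  shows "mset (invariant_orders G x) = mset \<nu>s"
proof -
  have G: "G \<in> carrier_mat p m"
    using eq by (rule local_ring.equivalent_carrier)
  obtain \<mu>s where \<mu>s: "is_invariant_orders G x \<mu>s" "length \<mu>s \<le> min p m"
    using exists_is_invariant_orders[OF G] .
  have mset: "mset \<xi>s = mset \<nu>s" if "is_invariant_orders G x \<xi>s" for \<xi>s
  proof (rule mset_eq_of_equivalent_local_diag)
    show "local_ring.equivalent x p m (local_diag p m x \<xi>s) (local_diag p m x \<nu>s)"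
      using local_ring.equivalent_trans[OF local_ring.equivalent_sym eq] that
      by (simp add: is_invariant_orders_iff[OF G])
    show "length \<xi>s \<le> min p m"
      using that \<mu>s by (simp add: is_invariant_orders_iff[OF G])
  qed (fact len)
  have "\<xi>s = sort \<nu>s" if "is_invariant_orders G x \<xi>s" for \<xi>s
    using mset[OF that] that by (metis is_invariant_orders_def properties_for_sort)
  then have "invariant_orders G x = \<mu>s"
    unfolding invariant_orders_def using \<mu>s by (intro the_equality) auto
  then show ?thesis
    using mset \<mu>s by simp
qed

section \<open>Minimal polynomial systems\<close>

lemma to_rat_mat_mats:
  "M \<in> carrier_mat p m \<Longrightarrow> to_rat_mat M \<in> local_ring.mats x p m"
  by (auto simp: local_ring.mats_def no_pole_at_to_fract)

lemma to_rat_mat_mult: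
  fixes M N :: "'a :: field poly mat"
  assumes "M \<in> carrier_mat p q" "N \<in> carrier_mat q m"
  shows "to_rat_mat (M * N) = to_rat_mat M * to_rat_mat N"
proof -
  interpret comm_ring_hom "to_fract :: 'a poly \<Rightarrow> 'a poly fract"
    by unfold_locales auto
  show ?thesis
    using assms by (rule mat_hom_mult)
qed

lemma det_to_rat_mat: "det (to_rat_mat M) = to_fract (det M)" for M :: "'a :: field poly mat"
proof -
  interpret comm_ring_hom "to_fract :: 'a poly \<Rightarrow> 'a poly fract"
    by unfold_locales auto
  show ?thesis
    by (rule hom_det)
qed

section \<open>From rank conditions at the point to identities over the local ring\<close>

text \<open>The solution at \<open>x\<close> is lifted to constant polynomial matrices. The
  resulting polynomial matrix \<open>H\<close> has the identity as its value at \<open>x\<close>, so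
  \<open>det H\<close> is a local unit, and multiplying by the inverse of \<open>H\<close> corrects
  the solution.\<close>

lemma exists_local_right_inverse:
  fixes A B :: "'a :: field poly mat"
  assumes A: "A \<in> carrier_mat n n" and B: "B \<in> carrier_mat n m"
    and X\<^sub>0: "X\<^sub>0 \<in> carrier_mat n n" and Y\<^sub>0: "Y\<^sub>0 \<in> carrier_mat m n"
    and eval: "eval_mat A x * X\<^sub>0 + eval_mat B x * Y\<^sub>0 = 1\<^sub>m n"
  obtains X Y where "X \<in> local_ring.mats x n n" "Y \<in> local_ring.mats x m n"
    "to_rat_mat A * X + to_rat_mat B * Y = 1\<^sub>m n"
proof -
  interpret ev: comm_ring_hom "\<lambda>q :: 'a poly. poly q x"
    by unfold_locales auto
  define X\<^sub>1 where "X\<^sub>1 = map_mat (\<lambda>c. [:c:]) X\<^sub>0"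
  define Y\<^sub>1 where "Y\<^sub>1 = map_mat (\<lambda>c. [:c:]) Y\<^sub>0"
  define H where "H = A * X\<^sub>1 + B * Y\<^sub>1"
  have c1: "X\<^sub>1 \<in> carrier_mat n n" "Y\<^sub>1 \<in> carrier_mat m n"
    using X\<^sub>0 Y\<^sub>0 by (simp_all add: X\<^sub>1_def Y\<^sub>1_def)
  note AX = mult_carrier_mat[OF A c1(1)] and BY = mult_carrier_mat[OF B c1(2)]
  have H: "H \<in> carrier_mat n n"
    unfolding H_def using AX BY by simp
  have "eval_mat X\<^sub>1 x = X\<^sub>0" "eval_mat Y\<^sub>1 x = Y\<^sub>0"
    by (auto simp: X\<^sub>1_def Y\<^sub>1_def intro!: eq_matI)
  moreover have "eval_mat H x = eval_mat (A * X\<^sub>1) x + eval_mat (B * Y\<^sub>1) x"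
    unfolding H_def using A B c1 by (intro eq_matI) auto
  ultimately have "eval_mat H x = 1\<^sub>m n"
    using eval by (simp add: ev.mat_hom_mult[OF A c1(1)] ev.mat_hom_mult[OF B c1(2)])
  then have "poly (det H) x = 1"
    by (simp flip: ev.hom_det)
  then have H_unit: "poly (det H) x \<noteq> 0"
    by simp
  have "inverse (det (to_rat_mat H)) = to_fract 1 / to_fract (det H)"
    by (simp add: det_to_rat_mat inverse_eq_divide)
  with H_unit have "no_pole_at (inverse (det (to_rat_mat H))) x"
    unfolding no_pole_at_iff by blast
  moreover have "det (to_rat_mat H) \<noteq> 0"
    using H_unit by (auto simp: det_to_rat_mat)
  ultimately have "to_rat_mat H \<in> local_ring.GL x n"
    by (intro local_ring.GL_of_unit_det to_rat_mat_mats H) auto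
  then obtain J where J: "J \<in> local_ring.GL x n" "to_rat_mat H * J = 1\<^sub>m n"
    by (rule local_ring.GL_inverse)
  note Jc = local_ring.GLD(2)[OF J(1)]
  have c: "to_rat_mat A \<in> carrier_mat n n" "to_rat_mat B \<in> carrier_mat n m"
    "to_rat_mat X\<^sub>1 \<in> carrier_mat n n" "to_rat_mat Y\<^sub>1 \<in> carrier_mat m n"
    using A B c1 by simp_all
  have "to_rat_mat H = to_rat_mat (A * X\<^sub>1) + to_rat_mat (B * Y\<^sub>1)"
    unfolding H_def using A B c1 by (intro eq_matI) auto
  also have "\<dots> = to_rat_mat A * to_rat_mat X\<^sub>1 + to_rat_mat B * to_rat_mat Y\<^sub>1"
    by (simp only: to_rat_mat_mult[OF A c1(1)] to_rat_mat_mult[OF B c1(2)])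
  finally have "1\<^sub>m n = (to_rat_mat A * to_rat_mat X\<^sub>1 + to_rat_mat B * to_rat_mat Y\<^sub>1) * J"
    using J by simp
  also have "\<dots> = to_rat_mat A * to_rat_mat X\<^sub>1 * J + to_rat_mat B * to_rat_mat Y\<^sub>1 * J"
    by (rule add_mult_distrib_mat[OF mult_carrier_mat[OF c(1,3)] mult_carrier_mat[OF c(2,4)] Jc])
  also have "to_rat_mat A * to_rat_mat X\<^sub>1 * J = to_rat_mat A * (to_rat_mat X\<^sub>1 * J)"
    by (rule assoc_mult_mat[OF c(1,3) Jc])
  also have "to_rat_mat B * to_rat_mat Y\<^sub>1 * J = to_rat_mat B * (to_rat_mat Y\<^sub>1 * J)"
    by (rule assoc_mult_mat[OF c(2,4) Jc])
  finally have "to_rat_mat A * (to_rat_mat X\<^sub>1 * J) + to_rat_mat B * (to_rat_mat Y\<^sub>1 * J) = 1\<^sub>m n"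
    by simp
  then show ?thesis
    using that[OF local_ring.mats_mult[OF to_rat_mat_mats[OF c1(1)] local_ring.GLD(1)[OF J(1)]]
        local_ring.mats_mult[OF to_rat_mat_mats[OF c1(2)] local_ring.GLD(1)[OF J(1)]]] by blast
qed

lemma append_cols_right_inverse:
  fixes M N :: "'a :: field mat"
  assumes M: "M \<in> carrier_mat n n" and N: "N \<in> carrier_mat n m"
    and L: "L \<in> carrier_mat (n + m) n" "append_cols M N * L = 1\<^sub>m n"
  obtains X Y where "X \<in> carrier_mat n n" "Y \<in> carrier_mat m n" "M * X + N * Y = 1\<^sub>m n"
proof
  let ?X = "mat n n (\<lambda>(i, j). L $$ (i, j))" and ?Y = "mat m n (\<lambda>(i, j). L $$ (n + i, j))"
  show X: "?X \<in> carrier_mat n n" and Y: "?Y \<in> carrier_mat m n"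
    by simp_all
  \<comment> \<open>\<open>append_cols\<close> is a block matrix with an empty lower row, so
    \<open>L\<close> is given an empty right column to make the block product apply.\<close>
  have "L = four_block_mat ?X (0\<^sub>m n 0) ?Y (0\<^sub>m m 0)"
    using L by (intro eq_matI) auto
  then have "append_cols M N * L = four_block_mat (M * ?X + N * ?Y) (M * 0\<^sub>m n 0 + N * 0\<^sub>m m 0)
      (0\<^sub>m 0 n * ?X + 0\<^sub>m 0 m * ?Y) (0\<^sub>m 0 n * 0\<^sub>m n 0 + 0\<^sub>m 0 m * 0\<^sub>m m 0)"
    unfolding append_cols_def using M N mult_four_block_mat[OF M N _ _ X _ Y, of "0\<^sub>m 0 n" 0 "0\<^sub>m 0 m" "0\<^sub>m n 0" 0 "0\<^sub>m m 0"]
    by simp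
  then have block: "1\<^sub>m n = four_block_mat (M * ?X + N * ?Y) (M * 0\<^sub>m n 0 + N * 0\<^sub>m m 0)
      (0\<^sub>m 0 n * ?X + 0\<^sub>m 0 m * ?Y) (0\<^sub>m 0 n * 0\<^sub>m n 0 + 0\<^sub>m 0 m * 0\<^sub>m m 0)"
    unfolding L(2) .
  show "M * ?X + N * ?Y = 1\<^sub>m n"
  proof (rule eq_matI)
    fix i j
    assume "i < dim_row (1\<^sub>m n :: 'a mat)" "j < dim_col (1\<^sub>m n :: 'a mat)"
    then show "(M * ?X + N * ?Y) $$ (i, j) = 1\<^sub>m n $$ (i, j)"
      unfolding block using M N by (subst index_mat_four_block) auto
  qed (use M N in auto)
qed

text \<open>Transposition turns stacked rows into adjacent columns. The conclusion stays transposed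
  so that it fits \<open>exists_local_right_inverse\<close>.\<close>

lemma append_rows_left_inverse:
  fixes M N :: "'a :: field mat"
  assumes M: "M \<in> carrier_mat n n" and N: "N \<in> carrier_mat m n"
    and L: "L \<in> carrier_mat n (n + m)" "L * (M @\<^sub>r N) = 1\<^sub>m n"
  obtains X Y where "X \<in> carrier_mat n n" "Y \<in> carrier_mat m n"
    "transpose_mat M * X + transpose_mat N * Y = 1\<^sub>m n"
proof -
  have "transpose_mat (M @\<^sub>r N) = append_cols (transpose_mat M) (transpose_mat N)"
    unfolding append_rows_def append_cols_def using M N
    by (subst transpose_four_block_mat[of _ n n _ 0 _ m]) auto
  moreover have "M @\<^sub>r N \<in> carrier_mat (n + m) n"
    using M N by (rule carrier_append_rows)
  ultimately have "append_cols (transpose_mat M) (transpose_mat N) * transpose_mat L = 1\<^sub>m n"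
    using transpose_mult[OF L(1), of "M @\<^sub>r N" n] L(2) by simp
  moreover have "transpose_mat L \<in> carrier_mat (n + m) n"
    using L by simp
  ultimately show ?thesis
    using append_cols_right_inverse[of "transpose_mat M" n "transpose_mat N" m "transpose_mat L"] M N that
    by auto
qed

lemma minimal_at_local_inverses:
  fixes A B C :: "'a :: field poly mat"
  assumes A: "A \<in> carrier_mat n n" and B: "B \<in> carrier_mat n m" and C: "C \<in> carrier_mat p n"
    and min: "minimal_at A B C x"
  shows "\<exists>X \<in> local_ring.mats x n n. \<exists>Y \<in> local_ring.mats x m n.
      to_rat_mat A * X + to_rat_mat B * Y = 1\<^sub>m n"
    and "\<exists>Z \<in> local_ring.mats x n n. \<exists>W \<in> local_ring.mats x n p.
      Z * to_rat_mat A + W * to_rat_mat C = 1\<^sub>m n"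
proof -
  have eA: "eval_mat A x \<in> carrier_mat n n" and eB: "eval_mat B x \<in> carrier_mat n m"
    and eC: "eval_mat C x \<in> carrier_mat p n"
    using A B C by simp_all
  have cols: "append_cols (eval_mat A x) (eval_mat B x) \<in> carrier_mat n (n + m)"
    unfolding append_cols_def using eA eB four_block_carrier_mat[OF eA, of "0\<^sub>m 0 m" 0 m] by simp
  have rows: "eval_mat A x @\<^sub>r eval_mat C x \<in> carrier_mat (n + p) n"
    using eA eC by (rule carrier_append_rows)
  have "\<exists>L \<in> carrier_mat (n + m) n. append_cols (eval_mat A x) (eval_mat B x) * L = 1\<^sub>m n"
  proof (cases "n = 0")
    \<comment> \<open>For an empty state matrix minimality is a convention and carries no rank
      information, but an identity of size 0 is trivially attained.\<close>
    case True
    then show ?thesis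
      using cols by (intro bexI[of _ "0\<^sub>m (n + m) n"]) (auto intro!: eq_matI)
  next
    case False
    then show ?thesis
      using min A by (intro full_rank_one_sided_inverse(1)[OF cols]) (simp add: minimal_at_def)
  qed
  then obtain L where L: "L \<in> carrier_mat (n + m) n" "append_cols (eval_mat A x) (eval_mat B x) * L = 1\<^sub>m n"
    by blast
  obtain X\<^sub>0 Y\<^sub>0 where XY: "X\<^sub>0 \<in> carrier_mat n n" "Y\<^sub>0 \<in> carrier_mat m n"
    "eval_mat A x * X\<^sub>0 + eval_mat B x * Y\<^sub>0 = 1\<^sub>m n"
    using append_cols_right_inverse[OF eA eB L] .
  show "\<exists>X \<in> local_ring.mats x n n. \<exists>Y \<in> local_ring.mats x m n.
      to_rat_mat A * X + to_rat_mat B * Y = 1\<^sub>m n"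
    using exists_local_right_inverse[OF A B XY] by blast
  have "\<exists>L \<in> carrier_mat n (n + p). L * (eval_mat A x @\<^sub>r eval_mat C x) = 1\<^sub>m n"
  proof (cases "n = 0")
    case True
    then show ?thesis
      using rows by (intro bexI[of _ "0\<^sub>m n (n + p)"]) (auto intro!: eq_matI)
  next
    case False
    then show ?thesis
      using min A by (intro full_rank_one_sided_inverse(2)[OF rows]) (simp add: minimal_at_def)
  qed
  then obtain K where K: "K \<in> carrier_mat n (n + p)" "K * (eval_mat A x @\<^sub>r eval_mat C x) = 1\<^sub>m n"
    by blast
  obtain Z\<^sub>0 W\<^sub>0 where ZW: "Z\<^sub>0 \<in> carrier_mat n n" "W\<^sub>0 \<in> carrier_mat p n"
    "transpose_mat (eval_mat A x) * Z\<^sub>0 + transpose_mat (eval_mat C x) * W\<^sub>0 = 1\<^sub>m n"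
    using append_rows_left_inverse[OF eA eC K] .
  have t: "transpose_mat A \<in> carrier_mat n n" "transpose_mat C \<in> carrier_mat n p"
    using A C by simp_all
  have "eval_mat (transpose_mat A) x * Z\<^sub>0 + eval_mat (transpose_mat C) x * W\<^sub>0 = 1\<^sub>m n"
    using ZW(3) by (simp add: map_mat_transpose)
  then obtain Z W where loc: "Z \<in> local_ring.mats x n n" "W \<in> local_ring.mats x p n"
    "to_rat_mat (transpose_mat A) * Z + to_rat_mat (transpose_mat C) * W = 1\<^sub>m n"
    using exists_local_right_inverse[OF t ZW(1,2)] by blast
  \<comment> \<open>The lifted solution is transposed back, giving the identity with
    \<open>A\<close> and \<open>C\<close> on the right.\<close>
  have loc_t: "transpose_mat Z \<in> local_ring.mats x n n" "transpose_mat W \<in> local_ring.mats x n p"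
    using loc by (auto simp: local_ring.mats_def)
  have c: "to_rat_mat (transpose_mat A) \<in> carrier_mat n n" "to_rat_mat (transpose_mat C) \<in> carrier_mat n p"
    "Z \<in> carrier_mat n n" "W \<in> carrier_mat p n"
    using A C loc local_ring.matsD by auto
  have "transpose_mat (to_rat_mat (transpose_mat A) * Z + to_rat_mat (transpose_mat C) * W) = 1\<^sub>m n"
    unfolding loc(3) by simp
  also have "transpose_mat (to_rat_mat (transpose_mat A) * Z + to_rat_mat (transpose_mat C) * W)
      = transpose_mat (to_rat_mat (transpose_mat A) * Z) + transpose_mat (to_rat_mat (transpose_mat C) * W)"
    using mult_carrier_mat[OF c(1,3)] mult_carrier_mat[OF c(2,4)] by (rule transpose_add)
  also have "\<dots> = transpose_mat Z * to_rat_mat A + transpose_mat W * to_rat_mat C"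
    unfolding transpose_mult[OF c(1,3)] transpose_mult[OF c(2,4)] by (simp add: map_mat_transpose)
  finally show "\<exists>Z \<in> local_ring.mats x n n. \<exists>W \<in> local_ring.mats x n p.
      Z * to_rat_mat A + W * to_rat_mat C = 1\<^sub>m n"
    using loc_t by blast
qed

theorem theorem3p6:
  fixes x\<^sub>0 :: "'a :: alg_closed_field"
    and G :: "'a poly fract mat"
    and A B C D P :: "'a poly mat"
    and n p m :: nat
  assumes "G \<in> carrier_mat p m"
    and "is_polynomial_system n p m A B C D"
    and "P = system_matrix A B C D"
    and "minimal_at A B C x\<^sub>0"
    and "transfer_function A B C D = G"
  shows "elementary_divisors A x\<^sub>0 = pole_elementary_divisors G x\<^sub>0 \<and>
         elementary_divisors P x\<^sub>0 = zero_elementary_divisors G x\<^sub>0"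
proof -
  let ?t = "to_fract [:-x\<^sub>0, 1:]"
  let ?\<O> = "{f. no_pole_at f x\<^sub>0}"
  have A: "A \<in> carrier_mat n n" and B: "B \<in> carrier_mat n m" and C: "C \<in> carrier_mat p n"
    and D: "D \<in> carrier_mat p m"
    using assms(2) by (simp_all add: is_polynomial_system_def)
  note rat [simp] = A[THEN to_rat_mat_mats[of _ _ _ x\<^sub>0], THEN local_ring.matsD]
  \<comment> \<open>For \<open>n = 0\<close> the determinant of the empty matrix is 1.\<close>
  have "det A \<noteq> 0"
    using assms(2) A by (cases "n = 0") (auto simp: is_polynomial_system_def det_def)
  then have det: "det (to_rat_mat A) \<noteq> 0"
    by (simp add: det_to_rat_mat)
  have "mat_inverse (to_rat_mat A) \<noteq> None"
    using mat_inverse(1)[OF rat, where b = "()"] det_non_zero_imp_unit[OF rat det, where b = "()"] by blast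
  then obtain J where "mat_inverse (to_rat_mat A) = Some J"
    by auto
  with mat_inverse(2)[OF rat this] have J: "J \<in> carrier_mat n n" "to_rat_mat A * J = 1\<^sub>m n"
    and G: "to_rat_mat D + to_rat_mat C * J * to_rat_mat B = G"
    using assms(5) by (auto simp: transfer_function_def)
  obtain X Y where XY: "X \<in> local_ring.mats x\<^sub>0 n n" "Y \<in> local_ring.mats x\<^sub>0 m n"
    "to_rat_mat A * X + to_rat_mat B * Y = 1\<^sub>m n"
    using minimal_at_local_inverses(1)[OF A B C assms(4)] by blast
  obtain Z W where ZW: "Z \<in> local_ring.mats x\<^sub>0 n n" "W \<in> local_ring.mats x\<^sub>0 n p"
    "Z * to_rat_mat A + W * to_rat_mat C = 1\<^sub>m n"
    using minimal_at_local_inverses(2)[OF A B C assms(4)] by blast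
  obtain \<nu>s where \<nu>s: "is_invariant_orders G x\<^sub>0 \<nu>s" "length \<nu>s \<le> min p m"
    using exists_is_invariant_orders[OF assms(1)] .
  define g where "g i = (if i < length \<nu>s then ?t powi (\<nu>s ! i) else 0)" for i
  have Gg: "local_ring.equivalent x\<^sub>0 p m G (rect_diag p m g)"
    using \<nu>s(1) unfolding is_invariant_orders_iff[OF assms(1)] local_diag_eq_rect_diag g_def[abs_def] by blast
  have msetG: "mset (invariant_orders G x\<^sub>0) = mset \<nu>s"
    using \<nu>s by (intro mset_invariant_orders[of x\<^sub>0 p m]) (simp_all add: is_invariant_orders_iff[OF assms(1)])
  have g_mem: "no_pole_at (g i) x\<^sub>0 \<longleftrightarrow> i \<ge> length \<nu>s \<or> \<nu>s ! i \<ge> 0" for i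
    using no_pole_at_to_fract[of 0 x\<^sub>0] by (auto simp: g_def no_pole_at_powi_iff)
  note equiv = local_ring.equivalent_of_transfer[OF to_rat_mat_mats[OF A] to_rat_mat_mats[OF B]
      to_rat_mat_mats[OF C] to_rat_mat_mats[OF D] J XY ZW Gg[folded G]]

  \<comment> \<open>Exponents of \<open>diag(I, N)\<close>: zeros for the identity, then the orders
    of \<open>G\<close> with negative ones replaced by 0, since \<open>N\<close> has 1 at the
    poles.\<close>
  define \<zeta>s where "\<zeta>s = replicate n 0 @ map (max 0) \<nu>s"
  have "to_rat_mat P = four_block_mat (to_rat_mat A) (to_rat_mat B) (- to_rat_mat C) (to_rat_mat D)"
    unfolding assms(3) system_matrix_def using A B C D by (intro eq_matI) auto
  moreover have "block_diag (1\<^sub>m n) (rect_diag p m (\<lambda>i. if g i \<in> ?\<O> then g i else 1))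
      = local_diag (n + p) (n + m) x\<^sub>0 \<zeta>s"
    unfolding block_diag_one_rect_diag local_diag_eq_rect_diag
    by (rule rect_diag_cong) (auto simp: \<zeta>s_def nth_append g_mem, auto simp: g_def max_def)
  ultimately have "local_ring.equivalent x\<^sub>0 (n + p) (n + m) (to_rat_mat P) (local_diag (n + p) (n + m) x\<^sub>0 \<zeta>s)"
    using equiv(1) by simp
  then have msetP: "mset (invariant_orders (to_rat_mat P) x\<^sub>0) = mset \<zeta>s"
    by (rule mset_invariant_orders) (use \<nu>s in \<open>simp add: \<zeta>s_def\<close>)

  \<comment> \<open>Exponents of \<open>diag(I, E)\<close>: zeros for the identity, the pole orders
    with sign reversed, and zeros that fill the \<open>m\<close> by \<open>m\<close> matrix
    \<open>E\<close>.\<close>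
  define \<pi>s where "\<pi>s = replicate n 0 @ map (\<lambda>\<nu>. max 0 (- \<nu>)) \<nu>s @ replicate (m - length \<nu>s) 0"
  have \<pi>s: "block_diag (1\<^sub>m n) (rect_diag m m (\<lambda>i. if i < p \<and> g i \<notin> ?\<O> then inverse (g i) else 1))
      = local_diag (n + m) (n + m) x\<^sub>0 \<pi>s"
    unfolding block_diag_one_rect_diag local_diag_eq_rect_diag using \<nu>s(2)
    by (intro rect_diag_cong) (auto simp: \<pi>s_def nth_append g_mem, auto simp: g_def max_def power_int_minus)
  obtain \<alpha>s where \<alpha>s: "is_invariant_orders (to_rat_mat A) x\<^sub>0 \<alpha>s"
    using exists_is_invariant_orders[OF rat] .
  have "mat_rank (to_rat_mat A) = n"
    using vec_space.det_rank_iff[OF rat] det rat by (simp add: mat_rank_def)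
  with \<alpha>s have len: "length \<alpha>s = n"
    and A\<alpha>: "local_ring.equivalent x\<^sub>0 n n (to_rat_mat A) (local_diag n n x\<^sub>0 \<alpha>s)"
    by (simp_all add: is_invariant_orders_iff[OF rat])
  have msetA: "mset (invariant_orders (to_rat_mat A) x\<^sub>0) = mset \<alpha>s"
    using A\<alpha> by (rule mset_invariant_orders) (simp add: len)
  \<comment> \<open>Only \<open>diag(A, I)\<close> is known to be equivalent to
    \<open>diag(I, E)\<close>, so the orders of \<open>A\<close> are compared after appending the
    \<open>m\<close> zeros of the identity.\<close>
  have pad: "block_diag (local_diag n n x\<^sub>0 \<alpha>s) (1\<^sub>m m) = local_diag (n + m) (n + m) x\<^sub>0 (\<alpha>s @ replicate m 0)"
    unfolding local_diag_eq_rect_diag block_diag_rect_diag_one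
    by (rule rect_diag_cong) (auto simp: len nth_append)
  have "local_ring.equivalent x\<^sub>0 (n + m) (n + m) (block_diag (to_rat_mat A) (1\<^sub>m m))
      (block_diag (local_diag n n x\<^sub>0 \<alpha>s) (1\<^sub>m m))"
    by (intro local_ring.equivalent_block_diag A\<alpha> local_ring.equivalent_refl one_carrier_mat)
  from local_ring.equivalent_trans[OF local_ring.equivalent_sym[OF this[unfolded pad]] equiv(2)[unfolded \<pi>s]]
  have \<alpha>\<pi>: "mset (\<alpha>s @ replicate m 0) = mset \<pi>s"
    by (rule mset_eq_of_equivalent_local_diag) (use \<nu>s len in \<open>simp_all add: \<pi>s_def\<close>)

  \<comment> \<open>Discarding zero orders removes all padding on both sides.\<close>
  have "filter_mset (\<lambda>\<nu>. \<nu> \<noteq> 0) (mset \<alpha>s) = filter_mset (\<lambda>\<nu>. \<nu> \<noteq> 0) (mset (\<alpha>s @ replicate m 0))"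
    by simp
  also have "\<dots> = filter_mset (\<lambda>\<nu>. \<nu> \<noteq> 0) (image_mset (\<lambda>\<nu>. max 0 (- \<nu>)) (mset \<nu>s))"
    unfolding \<alpha>\<pi> by (simp add: \<pi>s_def)
  finally have "elementary_divisors A x\<^sub>0 = {# [:-x\<^sub>0, 1:] ^ nat \<nu>. \<nu> \<in>#
      filter_mset (\<lambda>\<nu>. \<nu> \<noteq> 0) (image_mset (\<lambda>\<nu>. max 0 (- \<nu>)) (mset \<nu>s)) #}"
    by (simp only: elementary_divisors_def msetA)
  \<comment> \<open>\<open>max 0 (- \<nu>)\<close> is nonzero exactly for negative
    \<open>\<nu>\<close>, where it equals \<open>- \<nu>\<close>.\<close>
  also have "\<dots> = pole_elementary_divisors G x\<^sub>0"
    unfolding pole_elementary_divisors_def msetG by (induction \<nu>s) (auto simp: max_def)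
  finally have poles: "elementary_divisors A x\<^sub>0 = pole_elementary_divisors G x\<^sub>0" .
  have "elementary_divisors P x\<^sub>0 = {# [:-x\<^sub>0, 1:] ^ nat \<nu>. \<nu> \<in>#
      filter_mset (\<lambda>\<nu>. \<nu> \<noteq> 0) (image_mset (max 0) (mset \<nu>s)) #}"
    by (simp add: elementary_divisors_def msetP \<zeta>s_def)
  also have "\<dots> = zero_elementary_divisors G x\<^sub>0"
    unfolding zero_elementary_divisors_def msetG by (induction \<nu>s) (auto simp: max_def)
  finally show ?thesis
    using poles by simp
qed

end
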